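(* Let $N, r, d$ be positive integers and suppose we are given $N$ color classes of $r$ points of $\mathbb{R}^d$ each. Let $f(N)$ be the largest number of these color classes that a family $H_1,\ldots,H_r$ of half-spaces in $\mathbb{R}^d$ can split. Then: (1) there exists a colorful partition of the $Nr$ points into $r$ parts that remains a Tverberg partition even after the removal of any $t$ color classes, for any \[ t \le N - (1-p_r) f(N) - \sqrt{\frac{(d+1)(r-1) f(N) \ln(N r^2)}{2}} - 1; \] (2) every colorful partition of the points into $r$ parts fails to be a Tverberg partition after the removal of a suitable set of at most $N - \frac{1}{r!} f(N)$ color classes.
   Context: Color classes are disjoint sets of points. A family of half-spaces $H_1,\ldots,H_r$ in $\mathbb{R}^d$ can split a set $X$ of $r$ points if (i) $H_1\cap\cdots\cap H_r = \emptyset$, and (ii) for each $k=1,\ldots,r$, the union of any $k$ of the half-spaces contains at least $k$ points of $X$ (equivalently, the points of $X$ can be labelled $x_1,\ldots,x_r$ with $x_i\in H_i$ for each $i$). A colorful partition of the union of the color classes is a partition into $r$ parts each containing exactly one point of each color class; it is a Tverberg partition if the convex hulls of the parts have a common point. Removing a color class means deleting all of its points from all parts; a partition remains a Tverberg partition after a removal if the convex hulls of the remaining parts still intersect. $p_r$ is the probability that a uniformly random permutation of $\{1,\ldots,r\}$ has at least one fixed point. *)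

theory Defs
  imports "HOL-Probability.Probability" "HOL-Combinatorics.Permutations"
begin

text \<open>
  Half-spaces may be open or closed, but they have a nonzero normal vector, so neither the
  empty set nor the whole space is a half-space.
\<close>

definition halfspace :: "'a::euclidean_space set \<Rightarrow> bool" where
  "halfspace H \<longleftrightarrow> (\<exists>a b. a \<noteq> 0 \<and> (H = {x. a \<bullet> x \<le> b} \<or> H = {x. a \<bullet> x < b}))"

text \<open>
  Families of half-spaces are indexed by \<open>{1..r}\<close>; repetitions are allowed.
\<close>

definition splits :: "nat \<Rightarrow> (nat \<Rightarrow> 'a set) \<Rightarrow> 'a set \<Rightarrow> bool" where
  "splits r H X \<longleftrightarrow>
     (\<Inter>i\<in>{1..r}. H i) = {} \<and>
     (\<forall>k\<in>{1..r}. \<forall>J\<subseteq>{1..r}. card J = k \<longrightarrow> k \<le> card (X \<inter> (\<Union>i\<in>J. H i)))"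

text \<open>
  For \<open>r = 1\<close> no family has an empty intersection, and the maximum is \<open>0\<close>.
\<close>

definition max_split :: "nat \<Rightarrow> 'a::euclidean_space set set \<Rightarrow> nat" where
  "max_split r \<C> = Max {card {C \<in> \<C>. splits r H C} |H. \<forall>i\<in>{1..r}. halfspace (H i)}"

definition colorful_partition :: "nat \<Rightarrow> 'a set set \<Rightarrow> 'a set set \<Rightarrow> bool" where
  "colorful_partition r \<C> P \<longleftrightarrow>
     partition_on (\<Union>\<C>) P \<and> card P = r \<and> (\<forall>A\<in>P. \<forall>C\<in>\<C>. card (A \<inter> C) = 1)"

definition tverberg :: "'a::euclidean_space set set \<Rightarrow> bool" where
  "tverberg P \<longleftrightarrow> (\<Inter>A\<in>P. convex hull A) \<noteq> {}"

text \<open>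
  Parts that become empty are kept (as the empty set), so that removing all color classes
  destroys the Tverberg property.
\<close>

definition remove_classes :: "'a set set \<Rightarrow> 'a set set \<Rightarrow> 'a set set" where
  "remove_classes S P = (\<lambda>A. A - \<Union>S) ` P"

definition fixpoint_prob :: "nat \<Rightarrow> real" where
  "fixpoint_prob r =
     measure_pmf.prob (pmf_of_set {\<pi>. \<pi> permutes {1..r}}) {\<pi>. \<exists>i\<in>{1..r}. \<pi> i = i}"

end

theory Submission
  imports Defs
begin

text \<open>
  If removing the classes in \<open>S\<close> destroys the Tverberg property, then Sarkaria's tensor trick together
  with Gordan's alternative separates the convex hulls by affine functions \<open>g\<^sub>1, \<dots>, g\<^sub>r\<close> of sum zero,
  with \<open>g\<^sub>j > 0\<close> on the \<open>j\<close>-th part: every surviving class has its \<open>j\<close>-th point in the half-space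
  \<open>g\<^sub>j > 0\<close>. Such families form a vector space of dimension \<open>(d + 1) (r - 1)\<close>, so by the
  Sauer-Shelah lemma they induce at most \<open>(N r\<^sup>2) ^ ((d + 1) (r - 1))\<close> sign patterns on the \<open>N r\<^sup>2\<close>
  pairs (point, index). For a fixed pattern only the at most \<open>f(N)\<close> split classes can survive, and a
  random labelling of a split class is compatible with the pattern with probability at most
  \<open>1 - p\<^sub>r\<close>, because every point misses at least one half-space and derangements are the worst case.
  Hoeffding's inequality and a union bound over the patterns give (1). For (2), fix an optimal family of
  half-spaces; by Hall's theorem every split class is compatible with it after some permutation of
  the parts, and the most popular permutation serves at least \<open>f(N) / r!\<close> classes.
\<close>

subsection \<open>Sign patterns of linear functionals\<close>

text \<open>Gaussian elimination by induction on the coordinates: one vector that is nonzero at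
  \<open>k\<close> serves as pivot, and the others lose this coordinate.\<close>

lemma linear_dependence_fun:
  fixes y :: "'i \<Rightarrow> 'k \<Rightarrow> real"
  assumes "finite K" "finite I" "card K < card I"
  shows "\<exists>c. (\<exists>i\<in>I. c i \<noteq> 0) \<and> (\<forall>k\<in>K. (\<Sum>i\<in>I. c i * y i k) = 0)"
  using assms
proof (induction K arbitrary: I y rule: finite_induct)
  case empty
  then have "I \<noteq> {}" by auto
  then show ?case by (intro exI[of _ "\<lambda>_. 1"]) auto
next
  case (insert k K)
  show ?case
  proof (cases "\<forall>i\<in>I. y i k = 0")
    case True
    from insert have "card K < card I" by simp
    from insert.IH[OF insert.prems(1) this, of y] obtain c where
      c: "\<exists>i\<in>I. c i \<noteq> 0" "\<forall>k\<in>K. (\<Sum>i\<in>I. c i * y i k) = 0" by blast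
    with True show ?thesis by (intro exI[of _ c]) auto
  next
    case False
    then obtain i0 where i0: "i0 \<in> I" "y i0 k \<noteq> 0" by blast
    define J where "J = I - {i0}"
    \<comment> \<open>Subtracting a multiple of the pivot vector \<open>y i0\<close> clears
      coordinate \<open>k\<close>, so the induction hypothesis is needed on \<open>K\<close>
      only.\<close>
    define y' where "y' i l = y i l - y i k / y i0 k * y i0 l" for i l
    have "card K < card J" "finite J" using insert i0 by (auto simp: J_def)
    from insert.IH[OF this(2,1), of y'] obtain c where
      c: "\<exists>i\<in>J. c i \<noteq> 0" "\<And>l. l \<in> K \<Longrightarrow> (\<Sum>i\<in>J. c i * y' i l) = 0" by blast
    \<comment> \<open>The pivot's coefficient collects the subtracted multiples, so the combination
      of the \<open>y\<close> agrees with that of the \<open>y'\<close> in every coordinate.\<close>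
    define c0 where "c0 = - (\<Sum>i\<in>J. c i * (y i k / y i0 k))"
    have split: "(\<Sum>i\<in>I. (c(i0 := c0)) i * y i l) = c0 * y i0 l + (\<Sum>i\<in>J. c i * y i l)" for l
      using i0 insert.prems by (subst sum.remove[of _ i0]) (auto simp: J_def intro!: sum.cong)
    have "c0 * y i0 l + (\<Sum>i\<in>J. c i * y i l) = (\<Sum>i\<in>J. c i * y' i l)" for l
      unfolding y'_def c0_def
      by (simp add: algebra_simps sum_distrib_left sum_distrib_right sum_subtractf)
    then have "(\<Sum>i\<in>I. (c(i0 := c0)) i * y i l) = (\<Sum>i\<in>J. c i * y' i l)" for l
      by (simp only: split)
    moreover have "(\<Sum>i\<in>J. c i * y' i k) = 0" using i0 by (simp add: y'_def)
    ultimately have "\<forall>l\<in>insert k K. (\<Sum>i\<in>I. (c(i0 := c0)) i * y i l) = 0"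
      using c(2) by auto
    moreover have "\<exists>i\<in>I. (c(i0 := c0)) i \<noteq> 0" using c(1) by (auto simp: J_def)
    ultimately show ?thesis by blast
  qed
qed

definition shatters :: "'i set set \<Rightarrow> 'i set \<Rightarrow> bool" where
  "shatters F S \<longleftrightarrow> (\<forall>T\<subseteq>S. \<exists>A\<in>F. A \<inter> S = T)"

text \<open>Pajor's form of the Sauer-Shelah lemma. Split \<open>F\<close> by membership of
  \<open>x\<close> and apply induction to the two trace families on \<open>Q\<close>: a set
  \<open>S\<close> shattered by both accounts for two sets shattered by \<open>F\<close>, namely
  \<open>S\<close> and \<open>insert x S\<close>.\<close>

lemma card_le_card_shattered:
  fixes Q :: "'a set"
  assumes "finite Q" "F \<subseteq> Pow Q"
  shows "card F \<le> card {S \<in> Pow Q. shatters F S}"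
  using assms
proof (induction Q arbitrary: F rule: finite_induct)
  case empty
  then consider "F = {}" | "F = {{}}" by auto
  moreover have "{S \<in> Pow {}. shatters {{}} S} = {{} :: 'a set}" by (auto simp: shatters_def)
  ultimately show ?case by cases auto
next
  case (insert x Q)
  define F0 where "F0 = {A \<in> F. x \<notin> A}"
  define F1 where "F1 = (\<lambda>A. A - {x}) ` {A \<in> F. x \<in> A}"
  define s where "s G = {S \<in> Pow Q. shatters G S}" for G
  have fs: "finite (s G)" for G using insert.hyps by (simp add: s_def)
  have sub: "F0 \<subseteq> Pow Q" "F1 \<subseteq> Pow Q" using insert.prems by (auto simp: F0_def F1_def)
  have fF: "finite F" using insert.prems insert.hyps by (meson finite_Pow_iff finite_insert finite_subset)
  have "inj_on (\<lambda>A. A - {x}) {A \<in> F. x \<in> A}" by (auto simp: inj_on_def)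
  then have "card F1 = card {A \<in> F. x \<in> A}" unfolding F1_def by (rule card_image)
  moreover have "card F = card F0 + card {A \<in> F. x \<in> A}"
    unfolding F0_def using fF by (subst card_Un_disjoint[symmetric]) (auto intro: arg_cong[of _ _ card])
  ultimately have "card F = card F0 + card F1" by simp
  also have "\<dots> \<le> card (s F0) + card (s F1)"
    unfolding s_def by (intro add_mono insert.IH sub)
  also have "\<dots> = card (s F0 \<union> s F1) + card (s F0 \<inter> s F1)"
    by (rule card_Un_Int) (use fs in auto)
  \<comment> \<open>Sets counted twice are traded for their copies containing \<open>x\<close>,
    which differ from all subsets of \<open>Q\<close>.\<close>
  also have "card (s F0 \<inter> s F1) = card (insert x ` (s F0 \<inter> s F1))"
    using insert.hyps
    by (subst card_image) (auto simp: inj_on_def s_def dest!: insert_ident[THEN iffD1, rotated 2])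
  also have "card (s F0 \<union> s F1) + \<dots> = card ((s F0 \<union> s F1) \<union> insert x ` (s F0 \<inter> s F1))"
    using fs insert.hyps by (subst card_Un_disjoint) (auto simp: s_def)
  also have "\<dots> \<le> card {S \<in> Pow (insert x Q). shatters F S}"
  proof (rule card_mono)
    show "finite {S \<in> Pow (insert x Q). shatters F S}" using insert.hyps by simp
    have 0: "shatters F S" if "shatters F0 S" for S
    proof -
      have "F0 \<subseteq> F" by (auto simp: F0_def)
      with that show ?thesis unfolding shatters_def by (meson subsetD)
    qed
    have 1: "shatters F S" if "shatters F1 S" "x \<notin> S" for S
      unfolding shatters_def
    proof (intro allI impI)
      fix T assume "T \<subseteq> S"
      with that(1) obtain A' where "A' \<in> F1" "A' \<inter> S = T" unfolding shatters_def by blast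
      then obtain A where "A \<in> F" "(A - {x}) \<inter> S = T" by (auto simp: F1_def)
      then show "\<exists>A\<in>F. A \<inter> S = T" using that by (intro bexI[of _ A]) auto
    qed
    have 2: "shatters F (insert x S)" if "shatters F0 S" "shatters F1 S" "x \<notin> S" for S
      unfolding shatters_def
    proof (intro allI impI)
      fix T assume T: "T \<subseteq> insert x S"
      show "\<exists>A\<in>F. A \<inter> insert x S = T"
      proof (cases "x \<in> T")
        case True
        have "T - {x} \<subseteq> S" using T by auto
        with that(2) obtain A' where "A' \<in> F1" "A' \<inter> S = T - {x}" unfolding shatters_def by blast
        then obtain A where "A \<in> F" "x \<in> A" "(A - {x}) \<inter> S = T - {x}" by (auto simp: F1_def)
        then show ?thesis using True that by (intro bexI[of _ A]) auto
      next
        case False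
        then have "T \<subseteq> S" using T by auto
        with that(1) obtain A where "A \<in> F0" "A \<inter> S = T" unfolding shatters_def by blast
        then have "A \<in> F" "x \<notin> A" "A \<inter> S = T" by (auto simp: F0_def)
        then show ?thesis by (intro bexI[of _ A]) auto
      qed
    qed
    show "(s F0 \<union> s F1) \<union> insert x ` (s F0 \<inter> s F1) \<subseteq> {S \<in> Pow (insert x Q). shatters F S}"
    proof (intro Un_least subsetI)
      fix S assume "S \<in> s F0"
      then show "S \<in> {S \<in> Pow (insert x Q). shatters F S}" using 0 by (auto simp: s_def)
    next
      fix S assume S: "S \<in> s F1"
      then have "x \<notin> S" using insert.hyps by (auto simp: s_def)
      with S 1 show "S \<in> {S \<in> Pow (insert x Q). shatters F S}" by (auto simp: s_def)
    next
      fix S' assume "S' \<in> insert x ` (s F0 \<inter> s F1)"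
      then obtain S where S: "S' = insert x S" "S \<in> s F0" "S \<in> s F1" by blast
      then have "x \<notin> S" using insert.hyps by (auto simp: s_def)
      with S 2 show "S' \<in> {S \<in> Pow (insert x Q). shatters F S}" by (auto simp: s_def)
    qed
  qed
  finally show ?case .
qed

lemma card_subsets_card_le:
  assumes "finite Q"
  shows "card {S \<in> Pow Q. card S \<le> n} = (\<Sum>i\<le>n. card Q choose i)"
proof -
  have "{S \<in> Pow Q. card S \<le> n} = (\<Union>i\<le>n. {S. S \<subseteq> Q \<and> card S = i})" by auto
  also have "card \<dots> = (\<Sum>i\<le>n. card {S. S \<subseteq> Q \<and> card S = i})"
    using assms by (intro card_UN_disjoint) auto
  finally show ?thesis using assms by (simp add: n_subsets)
qed

text \<open>For \<open>n = 1\<close> the sum is \<open>m + 1\<close>, which exceeds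
  \<open>m\<close>, so the induction starts at 2. In the step, the old bound and the new binomial
  coefficient are each at most half of \<open>m ^ Suc k\<close>, the latter because
  \<open>fact (Suc k)\<close> is at least 2.\<close>

lemma sum_choose_le_power:
  fixes m n :: nat
  assumes "m \<ge> 2" "n \<ge> 2"
  shows "(\<Sum>i\<le>n. m choose i) \<le> m ^ n"
  using assms(2)
proof (induction n rule: dec_induct)
  case base
  obtain k where k: "m = k + 2" using assms by (metis add.commute le_Suc_ex)
  have "2 * (m choose 2) = m * (m - 1)" by (cases "even m") (auto simp: choose_two)
  then have "2 * (1 + m + (m choose 2)) \<le> 2 * m ^ 2"
    by (simp add: k power2_eq_square algebra_simps)
  then show ?case by (simp add: numeral_2_eq_2)
next
  case (step k)
  have "fact 2 \<le> (fact (Suc k) :: nat)" using step by (intro fact_mono_nat) simp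
  then have "2 * (m choose Suc k) \<le> (m choose Suc k) * fact (Suc k)"
    by (simp add: mult.commute del: fact_Suc)
  also have "\<dots> \<le> m ^ Suc k" by (rule binomial_fact_pow)
  finally have "2 * (m choose Suc k) \<le> m ^ Suc k" .
  moreover have "2 * m ^ k \<le> m ^ Suc k" using assms by simp
  ultimately show ?case using step.IH unfolding sum.atMost_Suc by linarith
qed

text \<open>More than \<open>card K\<close> vectors are linearly dependent, and a linear dependence
  rules out one sign pattern. Hence shattered sets have at most \<open>card K\<close> elements, and
  the Sauer-Shelah bound applies.\<close>

lemma card_linear_dichotomies:
  fixes y :: "'i \<Rightarrow> 'k \<Rightarrow> real"
  assumes "finite K" "finite Q"
  shows "card ((\<lambda>w. {p \<in> Q. (\<Sum>k\<in>K. w k * y p k) > 0}) ` W) \<le> (\<Sum>i\<le>card K. card Q choose i)"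
    (is "card ?F \<le> _")
proof -
  have "card S \<le> card K" if S: "S \<subseteq> Q" "shatters ?F S" for S
  proof (rule ccontr)
    assume "\<not> card S \<le> card K"
    then have "card K < card S" "finite S" using S assms finite_subset by auto
    from linear_dependence_fun[OF assms(1) this(2,1), of y] obtain c where
      c: "\<exists>i\<in>S. c i \<noteq> 0" "\<And>k. k \<in> K \<Longrightarrow> (\<Sum>i\<in>S. c i * y i k) = 0" by blast
    \<comment> \<open>The impossible pattern is the one positive exactly where \<open>b\<close> is:
      every term \<open>b p\<close> times the value at \<open>p\<close> would be nonnegative and one
      would be positive, yet the relation makes the total zero.\<close>
    have *: False if pos: "\<exists>i\<in>S. b i > 0" and z: "\<And>k. k \<in> K \<Longrightarrow> (\<Sum>i\<in>S. b i * y i k) = 0" for b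
    proof -
      have "{p \<in> S. b p > 0} \<subseteq> S" by auto
      with S(2) obtain w where w: "{p \<in> Q. (\<Sum>k\<in>K. w k * y p k) > 0} \<inter> S = {p \<in> S. b p > 0}"
        unfolding shatters_def by blast
      have sgn: "(\<Sum>k\<in>K. w k * y p k) > 0 \<longleftrightarrow> b p > 0" if "p \<in> S" for p
        using w that S(1) by blast
      have "(\<Sum>p\<in>S. b p * (\<Sum>k\<in>K. w k * y p k)) = (\<Sum>k\<in>K. w k * (\<Sum>p\<in>S. b p * y p k))"
        unfolding sum_distrib_left by (subst sum.swap) (simp add: mult_ac)
      also have "\<dots> = 0" using z by simp
      finally have "(\<Sum>p\<in>S. b p * (\<Sum>k\<in>K. w k * y p k)) = 0" .
      moreover have "(\<Sum>p\<in>S. b p * (\<Sum>k\<in>K. w k * y p k)) > 0"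
      proof -
        obtain i where i: "i \<in> S" "b i > 0" using pos by blast
        show ?thesis
        proof (rule sum_pos2[OF \<open>finite S\<close> i(1)])
          show "0 < b i * (\<Sum>k\<in>K. w k * y i k)" using i sgn by simp
          fix p assume "p \<in> S"
          then show "0 \<le> b p * (\<Sum>k\<in>K. w k * y p k)"
            using sgn[of p] by (cases "b p > 0") (auto intro: mult_nonpos_nonpos simp: not_less)
        qed
      qed
      ultimately show False by simp
    qed
    \<comment> \<open>If the relation has no positive coefficient, its negation has one.\<close>
    from c(1) obtain i where "i \<in> S" "c i > 0 \<or> - c i > 0" by (metis neg_0_less_iff_less linorder_neqE_linordered_idom)
    then show False using *[of c] *[of "\<lambda>i. - c i"] c(2) by (auto simp: sum_negf)
  qed
  then have "{S \<in> Pow Q. shatters ?F S} \<subseteq> {S \<in> Pow Q. card S \<le> card K}" by auto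
  then have "card {S \<in> Pow Q. shatters ?F S} \<le> card {S \<in> Pow Q. card S \<le> card K}"
    using assms by (intro card_mono) auto
  moreover have "card ?F \<le> card {S \<in> Pow Q. shatters ?F S}"
    by (rule card_le_card_shattered) (use assms in auto)
  ultimately show ?thesis using card_subsets_card_le[OF assms(2)] by simp
qed

subsection \<open>Gordan's alternative, Hall's theorem and derangements\<close>

text \<open>Serves two repairs: turning an equality into a strict inequality in Gordan's
  alternative, and making all normals of a separating family nonzero.\<close>

lemma eventually_perturbation_pos:
  fixes u v :: "'i \<Rightarrow> real"
  assumes "finite Q" "\<And>p. p \<in> Q \<Longrightarrow> u p > 0"
  shows "\<forall>\<^sub>F \<epsilon> in at_right 0. \<forall>p\<in>Q. u p + \<epsilon> * v p > 0"
proof (intro eventually_ball_finite assms(1) ballI)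
  fix p assume "p \<in> Q"
  have "((\<lambda>\<epsilon>. u p + \<epsilon> * v p) \<longlongrightarrow> u p + 0 * v p) (at_right 0)"
    by (intro tendsto_intros)
  then show "\<forall>\<^sub>F \<epsilon> in at_right 0. u p + \<epsilon> * v p > 0"
    by (rule order_tendstoD) (use assms(2)[OF \<open>p \<in> Q\<close>] in simp)
qed

text \<open>Elementary induction on the vectors. If a solution \<open>w0\<close> for
  \<open>Q\<close> is negative at the new vector, the old vectors are projected along it onto the
  kernel of \<open>w0\<close>, and the induction hypothesis is applied to the projections.\<close>

lemma gordan_alternative:
  fixes y :: "'i \<Rightarrow> 'k \<Rightarrow> real"
  assumes "finite K" "finite Q"
  shows "(\<exists>w. \<forall>p\<in>Q. (\<Sum>k\<in>K. w k * y p k) > 0) \<or>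
         (\<exists>c. (\<forall>p\<in>Q. c p \<ge> 0) \<and> (\<exists>p\<in>Q. c p > 0) \<and> (\<forall>k\<in>K. (\<Sum>p\<in>Q. c p * y p k) = 0))"
  using assms(2)
proof (induction Q arbitrary: y rule: finite_induct)
  case empty
  then show ?case by simp
next
  case (insert q Q)
  define dot where "dot w v = (\<Sum>k\<in>K. w k * v k)" for w v :: "'k \<Rightarrow> real"
  have dot_add: "dot (\<lambda>k. w k + a * v k) z = dot w z + a * dot v z"
    and dot_add': "dot z (\<lambda>k. w k + a * v k) = dot z w + a * dot z v" for w v z a
    by (simp_all add: dot_def algebra_simps sum.distrib sum_distrib_left)
  define sol where "sol S y \<longleftrightarrow> (\<exists>w. \<forall>p\<in>S. dot w (y p) > 0)" for S and y :: "'i \<Rightarrow> 'k \<Rightarrow> real"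
  define dep where "dep S y \<longleftrightarrow> (\<exists>c. (\<forall>p\<in>S. c p \<ge> 0) \<and> (\<exists>p\<in>S. c p > 0) \<and>
    (\<forall>k\<in>K. (\<Sum>p\<in>S. c p * y p k) = 0))" for S and y :: "'i \<Rightarrow> 'k \<Rightarrow> real"
  have IH: "sol Q z \<or> dep Q z" for z
    using insert.IH[of z] unfolding sol_def dep_def dot_def .
  have extend: "dep (insert q Q) y"
    if "\<forall>p\<in>Q. c p \<ge> 0" "c0 \<ge> 0" "c0 > 0 \<or> (\<exists>p\<in>Q. c p > 0)"
       "\<And>k. k \<in> K \<Longrightarrow> c0 * y q k + (\<Sum>p\<in>Q. c p * y p k) = 0" for c c0
  proof -
    have "(\<Sum>p\<in>insert q Q. (c(q := c0)) p * y p k) = c0 * y q k + (\<Sum>p\<in>Q. c p * y p k)" for k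
      using insert.hyps by (subst sum.insert) (auto intro!: sum.cong)
    then show ?thesis unfolding dep_def using that insert.hyps(2)
      by (intro exI[of _ "c(q := c0)"]) auto
  qed
  \<comment> \<open>A functional that vanishes at \<open>q\<close> and is positive on
    \<open>Q\<close> is tilted slightly towards one that is positive at \<open>q\<close>.\<close>
  have perturb: "sol (insert q Q) y"
    if w: "\<And>p. p \<in> Q \<Longrightarrow> dot w (y p) > 0" "dot w (y q) = 0" and v: "dot v (y q) > 0" for w v
  proof -
    have "\<forall>\<^sub>F \<epsilon> in at_right 0. (\<forall>p\<in>Q. dot w (y p) + \<epsilon> * dot v (y p) > 0) \<and> \<epsilon> > 0"
      by (intro eventually_conj eventually_perturbation_pos insert.hyps w eventually_at_right_less)
    then obtain \<epsilon> where "\<forall>p\<in>Q. dot w (y p) + \<epsilon> * dot v (y p) > 0" "\<epsilon> > 0"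
      using eventually_happens'[OF trivial_limit_at_right_real] by blast
    then show ?thesis unfolding sol_def using w v
      by (intro exI[of _ "\<lambda>k. w k + \<epsilon> * v k"]) (auto simp: dot_add)
  qed
  consider (dep) "dep Q y" | (w) w0 where "\<And>p. p \<in> Q \<Longrightarrow> dot w0 (y p) > 0"
    using IH[of y] unfolding sol_def by blast
  then have "sol (insert q Q) y \<or> dep (insert q Q) y"
  proof cases
    case dep
    then show ?thesis unfolding dep_def[of Q] using extend[where ?c0.0 = 0] by auto
  next
    case (w w0)
    consider "dot w0 (y q) > 0" | "dot w0 (y q) = 0" | "dot w0 (y q) < 0" by linarith
    then show ?thesis
    proof cases
      case 1
      then show ?thesis using w unfolding sol_def by blast
    next
      case 2
      \<comment> \<open>Tilt towards \<open>y q\<close> itself; if \<open>y q\<close> is zero on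
        \<open>K\<close>, then \<open>q\<close> alone is a dependence.\<close>
      show ?thesis
      proof (cases "\<exists>k\<in>K. y q k \<noteq> 0")
        case True
        then obtain k where k: "k \<in> K" "y q k \<noteq> 0" by blast
        then have "dot (y q) (y q) > 0" unfolding dot_def
          by (intro sum_pos2[OF assms(1) k(1)]) (auto simp: zero_less_mult_iff)
        then show ?thesis using perturb[OF w 2] by blast
      next
        case False
        then show ?thesis using extend[of "\<lambda>_. 0" 1] by auto
      qed
    next
      case 3
      \<comment> \<open>This choice makes \<open>w0\<close> vanish on every \<open>y' p\<close>. As
        \<open>t p\<close> is negative, \<open>y' p\<close> is a nonnegative combination of
        \<open>y p\<close> and \<open>y q\<close>, so a dependence of the \<open>y'\<close> is one
        of the \<open>y\<close>.\<close>
      define t where "t p = dot w0 (y p) / dot w0 (y q)" for p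
      define y' where "y' p k = y p k + (- t p) * y q k" for p k
      have t: "t p < 0" if "p \<in> Q" for p using w[OF that] 3 by (simp add: t_def divide_pos_neg)
      from IH[of y'] show ?thesis
      proof
        assume "sol Q y'"
        then obtain w' where w': "\<And>p. p \<in> Q \<Longrightarrow> dot w' (y' p) > 0" unfolding sol_def by blast
        \<comment> \<open>The multiple of \<open>w0\<close> makes \<open>w1\<close> vanish at
          \<open>q\<close>, and its value at \<open>y p\<close> is that of \<open>w'\<close> at
          \<open>y' p\<close>. Tilting \<open>w1\<close> towards \<open>- w0\<close> then solves all
          inequalities.\<close>
        define w1 where "w1 k = w' k + (- (dot w' (y q) / dot w0 (y q))) * w0 k" for k
        have "dot w1 (y p) = dot w' (y' p)" for p
          unfolding w1_def[abs_def] y'_def[abs_def] dot_add dot_add' t_def by (simp add: field_simps)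
        then have "dot w1 (y p) > 0" if "p \<in> Q" for p using w' that by simp
        moreover have "dot w1 (y q) = 0"
          unfolding w1_def[abs_def] dot_add using 3 by (simp add: field_simps)
        moreover have "dot (\<lambda>k. 0 + (-1) * w0 k) (y q) > 0"
          unfolding dot_add using 3 by (simp add: dot_def)
        ultimately show ?thesis using perturb by blast
      next
        assume "dep Q y'"
        then obtain c where c: "\<And>p. p \<in> Q \<Longrightarrow> c p \<ge> 0" "\<exists>p\<in>Q. c p > 0"
          "\<And>k. k \<in> K \<Longrightarrow> (\<Sum>p\<in>Q. c p * y' p k) = 0" unfolding dep_def by blast
        have "dep (insert q Q) y"
        proof (rule extend[where c = c and ?c0.0 = "\<Sum>p\<in>Q. c p * (- t p)"])
          show "0 \<le> (\<Sum>p\<in>Q. c p * (- t p))"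
            using c(1) t by (intro sum_nonneg mult_nonneg_nonneg) (auto simp: less_imp_le)
          fix k assume "k \<in> K"
          from c(3)[OF this] show "(\<Sum>p\<in>Q. c p * (- t p)) * y q k + (\<Sum>p\<in>Q. c p * y p k) = 0"
            by (simp add: y'_def algebra_simps sum.distrib sum_distrib_right sum_distrib_left sum_subtractf sum_negf)
        qed (use c in auto)
        then show ?thesis ..
      qed
    qed
  qed
  then show ?case unfolding sol_def dep_def dot_def .
qed

text \<open>The Halmos-Vaughan argument. A proper nonempty tight subset is matched first and its
  values are removed for the rest; without such a subset, any single pair can be matched and
  removed.\<close>

lemma hall_marriage:
  assumes "finite I" "\<And>i. i \<in> I \<Longrightarrow> finite (A i)"
    "\<And>J. J \<subseteq> I \<Longrightarrow> card J \<le> card (\<Union>(A ` J))"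
  shows "\<exists>f. inj_on f I \<and> (\<forall>i\<in>I. f i \<in> A i)"
  using assms
proof (induction I arbitrary: A rule: finite_psubset_induct)
  case (psubset I)
  note fin = psubset.prems(1) and hall = psubset.prems(2)
  have finJ: "finite (\<Union>(A ` J))" if "J \<subseteq> I" for J
    using that fin psubset.hyps finite_subset by blast
  show ?case
  proof (cases "\<exists>J. J \<subset> I \<and> J \<noteq> {} \<and> card (\<Union>(A ` J)) \<le> card J")
    case True
    then obtain J where J: "J \<subset> I" "J \<noteq> {}" "card (\<Union>(A ` J)) \<le> card J" by blast
    have "\<exists>f. inj_on f J \<and> (\<forall>i\<in>J. f i \<in> A i)"
      by (rule psubset.IH) (use J fin hall in auto)
    then obtain f where f: "inj_on f J" "\<forall>i\<in>J. f i \<in> A i" by blast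
    have "\<exists>g. inj_on g (I - J) \<and> (\<forall>i\<in>I - J. g i \<in> A i - \<Union>(A ` J))"
    proof (rule psubset.IH)
      show "I - J \<subset> I" using J by auto
      fix L assume L: "L \<subseteq> I - J"
      \<comment> \<open>Hall's condition for \<open>L \<union> J\<close> minus tightness of
        \<open>J\<close> gives the condition for \<open>L\<close> with the values of
        \<open>J\<close> deleted.\<close>
      have "card L + card J = card (L \<union> J)"
        using L J psubset.hyps by (intro card_Un_disjoint[symmetric]) (auto intro: finite_subset)
      also have "\<dots> \<le> card (\<Union>(A ` (L \<union> J)))" by (intro hall) (use L J in auto)
      also have "\<Union>(A ` (L \<union> J)) = (\<Union>i\<in>L. A i - \<Union>(A ` J)) \<union> \<Union>(A ` J)" by auto
      also have "card \<dots> \<le> card (\<Union>i\<in>L. A i - \<Union>(A ` J)) + card (\<Union>(A ` J))"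
        by (rule card_Un_le)
      finally show "card L \<le> card (\<Union>i\<in>L. A i - \<Union>(A ` J))" using J by simp
    qed (use fin in auto)
    then obtain g where g: "inj_on g (I - J)" "\<forall>i\<in>I - J. g i \<in> A i - \<Union>(A ` J)" by blast
    define h where "h i = (if i \<in> J then f i else g i)" for i
    have "inj_on h I"
    proof (rule inj_onI)
      fix i j assume ij: "i \<in> I" "j \<in> I" "h i = h j"
      have "h l \<in> \<Union>(A ` J) \<longleftrightarrow> l \<in> J" if "l \<in> I" for l
        using f(2) g(2) that by (auto simp: h_def)
      with ij have "i \<in> J \<longleftrightarrow> j \<in> J" by metis
      then show "i = j" using ij inj_onD[OF f(1)] inj_onD[OF g(1)]
        by (cases "i \<in> J") (simp_all add: h_def)
    qed
    moreover have "\<forall>i\<in>I. h i \<in> A i" using f g by (auto simp: h_def)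
    ultimately show ?thesis by blast
  next
    case strict: False
    show ?thesis
    proof (cases "I = {}")
      case True
      then show ?thesis by simp
    next
      case ne: False
      then obtain i where i: "i \<in> I" by blast
      then have "A i \<noteq> {}" using hall[of "{i}"] by auto
      then obtain x where x: "x \<in> A i" by blast
      have "\<exists>f. inj_on f (I - {i}) \<and> (\<forall>j\<in>I - {i}. f j \<in> A j - {x})"
      proof (rule psubset.IH)
        fix J assume J: "J \<subseteq> I - {i}"
        then have JI: "J \<subseteq> I" by auto
        show "card J \<le> card (\<Union>j\<in>J. A j - {x})"
        proof (cases "J = {}")
          case False
          \<comment> \<open>Strictness leaves one spare value, which pays for the deletion of
            \<open>x\<close>.\<close>
          with J i have "card J < card (\<Union>(A ` J))"
            using strict by (metis Diff_iff insertI1 linorder_not_le psubsetI subset_iff)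
          also have "(\<Union>(A ` J)) \<subseteq> insert x (\<Union>j\<in>J. A j - {x})" by auto
          then have "card (\<Union>(A ` J)) \<le> card (insert x (\<Union>j\<in>J. A j - {x}))"
            using finJ[OF JI] by (intro card_mono) auto
          also have "\<dots> \<le> Suc (card (\<Union>j\<in>J. A j - {x}))" by (rule card_insert_le_m1) auto
          finally show ?thesis by simp
        qed simp
      qed (use i fin in auto)
      then obtain f where "inj_on f (I - {i})" "\<forall>j\<in>I - {i}. f j \<in> A j - {x}" by blast
      then have "inj_on (f(i := x)) I" "\<forall>j\<in>I. (f(i := x)) j \<in> A j"
        using x by (auto simp: inj_on_def)
      then show ?thesis by blast
    qed
  qed
qed

text \<open>
  Moving the forbidden value of one point from \<open>a\<close> to an unused value \<open>b\<close> does not decrease the number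
  of admissible permutations: composing with the transposition of \<open>a\<close> and \<open>b\<close> injects the lost ones
  into the gained ones. Repeating this makes \<open>g\<close> a bijection.
\<close>

lemma card_permutes_avoiding_le:
  assumes "finite S" "g ` S \<subseteq> S"
  shows "card {\<pi>. \<pi> permutes S \<and> (\<forall>j\<in>S. g (\<pi> j) \<noteq> j)}
       \<le> card {\<pi>. \<pi> permutes S \<and> (\<forall>j\<in>S. \<pi> j \<noteq> j)}"
  using assms(2)
proof (induction "card (S - g ` S)" arbitrary: g rule: less_induct)
  case less
  define ok where "ok g = {\<pi>. \<pi> permutes S \<and> (\<forall>j\<in>S. g (\<pi> j) \<noteq> j)}" for g :: "'a \<Rightarrow> 'a"
  have fin: "finite (ok g)" for g
    unfolding ok_def using finite_permutations[OF assms(1)] by (rule rev_finite_subset) auto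
  show ?case
  proof (cases "g ` S = S")
    case True
    \<comment> \<open>When \<open>g\<close> is a bijection of \<open>S\<close>, composing with it
      turns the avoiding permutations into derangements.\<close>
    define h where "h x = (if x \<in> S then g x else x)" for x
    have "inj_on g S" using True assms(1) by (simp add: eq_card_imp_inj_on)
    then have "bij_betw h S S" using True by (auto simp: bij_betw_def h_def inj_on_def)
    then have h: "h permutes S" by (rule bij_imp_permutes) (simp add: h_def)
    have inS: "\<pi> j \<in> S" if "\<pi> permutes S" "j \<in> S" for \<pi> j
      using that by (simp add: permutes_in_image)
    show ?thesis
    proof (rule card_inj_on_le[of "\<lambda>\<pi>. h \<circ> \<pi>"])
      have "inj h" using h by (rule permutes_inj)
      then show "inj_on ((\<circ>) h) {\<pi>. \<pi> permutes S \<and> (\<forall>j\<in>S. g (\<pi> j) \<noteq> j)}"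
        by (auto simp: inj_on_def fun_eq_iff)
      show "(\<circ>) h ` {\<pi>. \<pi> permutes S \<and> (\<forall>j\<in>S. g (\<pi> j) \<noteq> j)}
          \<subseteq> {\<pi>. \<pi> permutes S \<and> (\<forall>j\<in>S. \<pi> j \<noteq> j)}"
        using h inS by (auto intro: permutes_compose simp: h_def)
      show "finite {\<pi>. \<pi> permutes S \<and> (\<forall>j\<in>S. \<pi> j \<noteq> j)}"
        using fin[of "\<lambda>x. x"] by (simp add: ok_def)
    qed
  next
    case False
    with less.prems obtain b where b: "b \<in> S" "b \<notin> g ` S" by blast
    have "\<not> inj_on g S" using False assms(1) less.prems by (meson endo_inj_surj)
    then obtain i i' where i: "i \<in> S" "i' \<in> S" "i \<noteq> i'" "g i = g i'" by (auto simp: inj_on_def)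
    define a where "a = g i"
    \<comment> \<open>Since \<open>i'\<close> still takes the value \<open>a\<close>, the image
      gains \<open>b\<close> and loses nothing, which drives the induction.\<close>
    define g' where "g' = g(i := b)"
    have ab: "a \<in> S" "a \<noteq> b" using i b less.prems by (auto simp: a_def)
    have im: "g' ` S = insert b (g ` S)" using i by (auto simp: g'_def image_iff)
    have "card (ok g) \<le> card (ok g')"
    proof -
      define T where "T \<pi> = \<pi> \<circ> Transposition.transpose a b" for \<pi> :: "'a \<Rightarrow> 'a"
      have "T ` (ok g - ok g') \<subseteq> ok g' - ok g"
      proof
        fix \<sigma> assume "\<sigma> \<in> T ` (ok g - ok g')"
        then obtain \<pi> where \<pi>: "\<sigma> = T \<pi>" "\<pi> \<in> ok g" "\<pi> \<notin> ok g'" by blast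
        then have per: "\<pi> permutes S" and av: "\<And>j. j \<in> S \<Longrightarrow> g (\<pi> j) \<noteq> j" by (auto simp: ok_def)
        then obtain j where "j \<in> S" "g' (\<pi> j) = j" using \<pi> by (auto simp: ok_def)
        \<comment> \<open>\<open>g\<close> and \<open>g'\<close> differ at \<open>i\<close> only, so
          a permutation allowed by \<open>g\<close> but not by \<open>g'\<close> must send
          \<open>b\<close> to \<open>i\<close>.\<close>
        then have \<pi>b: "\<pi> b = i" using av by (auto simp: g'_def split: if_splits)
        have inj: "\<pi> u = \<pi> v \<longleftrightarrow> u = v" for u v using permutes_inj[OF per] by (auto simp: inj_def)
        have inS: "\<pi> j \<in> S \<longleftrightarrow> j \<in> S" for j using per by (simp add: permutes_in_image)
        have \<sigma>: "\<sigma> a = i" "\<sigma> b = \<pi> a" "\<And>j. j \<noteq> a \<Longrightarrow> j \<noteq> b \<Longrightarrow> \<sigma> j = \<pi> j"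
          using \<pi>b \<pi> by (auto simp: T_def)
        have "\<sigma> permutes S" unfolding \<pi> T_def
          by (intro permutes_compose permutes_swap_id per ab b)
        moreover have "g' (\<sigma> j) \<noteq> j" if j: "j \<in> S" for j
        proof -
          consider "j = a" | "j = b" | "j \<noteq> a" "j \<noteq> b" by blast
          then show ?thesis
          proof cases
            case 1
            then show ?thesis using \<sigma> ab by (auto simp: g'_def)
          next
            case 2
            have "\<pi> a \<noteq> i" using inj[of a b] ab \<pi>b by auto
            moreover have "g (\<pi> a) \<noteq> b" using b ab inS by blast
            ultimately show ?thesis using 2 \<sigma> by (auto simp: g'_def)
          next
            case 3
            then have "\<pi> j \<noteq> i" using inj[of j b] \<pi>b by auto
            then show ?thesis using 3 \<sigma> av[OF j] by (auto simp: g'_def)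
          qed
        qed
        moreover have "g (\<sigma> a) = a" using \<sigma> by (simp add: a_def)
        ultimately show "\<sigma> \<in> ok g' - ok g" using ab by (auto simp: ok_def)
      qed
      moreover have "inj_on T (ok g - ok g')"
      proof (rule inj_onI)
        fix p q assume "T p = T q"
        then have "T (T p) = T (T q)" by simp
        then show "p = q" by (simp add: T_def comp_assoc)
      qed
      ultimately have "card (ok g - ok g') \<le> card (ok g' - ok g)"
        using fin by (intro card_inj_on_le[of T]) auto
      then show ?thesis using fin card_Diff_subset_Int[of "ok g" "ok g'"]
          card_Diff_subset_Int[of "ok g'" "ok g"] card_mono[of "ok g" "ok g \<inter> ok g'"]
          card_mono[of "ok g'" "ok g \<inter> ok g'"]
        by (auto simp: Int_commute)
    qed
    also have "card (S - g' ` S) < card (S - g ` S)"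
      using b im assms(1) by (intro psubset_card_mono) auto
    then have "card (ok g') \<le> card {\<pi>. \<pi> permutes S \<and> (\<forall>j\<in>S. \<pi> j \<noteq> j)}"
      unfolding ok_def using less.prems b im by (intro less.hyps) auto
    finally show ?thesis by (simp add: ok_def)
  qed
qed

subsection \<open>Balanced families of half-spaces\<close>

text \<open>
  The tensor product of \<open>(x, 1)\<close> with the \<open>j\<close>-th Sarkaria vector: the vectors for \<open>j < r\<close> are the unit
  vectors of dimension \<open>r - 1\<close>, and the one for \<open>j = r\<close> is minus their sum.
\<close>

definition sarkaria :: "nat \<Rightarrow> nat \<times> 'a::euclidean_space \<Rightarrow> ('a \<times> real) \<times> nat \<Rightarrow> real" where
  "sarkaria r p k = (if fst p = snd k then 1 else if fst p = r then - 1 else 0) * (fst k \<bullet> (snd p, 1))"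

lemma sarkaria_Pair:
  "sarkaria r (j, x) (b, l) = (if j = l then 1 else if j = r then - 1 else 0) * (b \<bullet> (x, 1))"
  by (simp add: sarkaria_def)

text \<open>Coordinates of the tensor product; their number is the exponent in the count of sign
  patterns.\<close>

definition sarkaria_index :: "nat \<Rightarrow> (('a::euclidean_space \<times> real) \<times> nat) set" where
  "sarkaria_index r = Basis \<times> {1..<r}"

lemma finite_sarkaria_index [simp]: "finite (sarkaria_index r)"
  by (simp add: sarkaria_index_def)

lemma card_sarkaria_index:
  "card (sarkaria_index r :: (('a::euclidean_space \<times> real) \<times> nat) set) = (DIM('a) + 1) * (r - 1)"
  by (simp add: sarkaria_index_def card_cartesian_product)

text \<open>A balanced family is a linear functional on the tensor product: the components below
  \<open>r\<close> are its free coordinates, and the minus sign in the last Sarkaria vector encodes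
  that \<open>G r\<close> is minus their sum.\<close>

lemma sum_sarkaria_balanced:
  fixes G :: "nat \<Rightarrow> 'a::euclidean_space \<times> real"
  assumes "(\<Sum>j\<in>{1..r}. G j) = 0" "j \<in> {1..r}"
  shows "(\<Sum>k\<in>sarkaria_index r. (G (snd k) \<bullet> fst k) * sarkaria r (j, x) k) = G j \<bullet> (x, 1)"
proof -
  let ?z = "(x, 1::real)"
  let ?c = "\<lambda>l. if j = l then 1 else if j = r then - 1 else (0::real)"
  have "(\<Sum>k\<in>sarkaria_index r. (G (snd k) \<bullet> fst k) * sarkaria r (j, x) k)
      = (\<Sum>b\<in>Basis. \<Sum>l\<in>{1..<r}. (G l \<bullet> b) * (?c l * (b \<bullet> ?z)))"
    by (simp add: sarkaria_index_def sum.cartesian_product sarkaria_def case_prod_unfold)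
  also have "\<dots> = (\<Sum>l\<in>{1..<r}. ?c l * (\<Sum>b\<in>Basis. (G l \<bullet> b) * (?z \<bullet> b)))"
    by (subst sum.swap) (simp add: sum_distrib_left mult_ac inner_commute)
  also have "\<dots> = (\<Sum>l\<in>{1..<r}. ?c l * (G l \<bullet> ?z))"
    by (simp only: euclidean_inner[symmetric])
  also have "\<dots> = G j \<bullet> ?z"
  proof (cases "j = r")
    case True
    have "{1..r} = insert r {1..<r}" using assms(2) by auto
    then have "G r = - (\<Sum>l\<in>{1..<r}. G l)" using assms(1) by (simp add: eq_neg_iff_add_eq_0)
    moreover have "(\<Sum>l\<in>{1..<r}. ?c l * (G l \<bullet> ?z)) = (\<Sum>l\<in>{1..<r}. - (G l \<bullet> ?z))"
      using True by (intro sum.cong) auto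
    ultimately show ?thesis using True by (simp add: inner_sum_left sum_negf)
  next
    case False
    then have "(\<Sum>l\<in>{1..<r}. ?c l * (G l \<bullet> ?z)) = (\<Sum>l\<in>{1..<r}. if l = j then G l \<bullet> ?z else 0)"
      by (intro sum.cong) auto
    with False assms(2) show ?thesis by simp
  qed
  finally show ?thesis .
qed

text \<open>Converse translation: the coefficients give the components below \<open>r\<close>, and
  balance dictates the last one.\<close>

lemma ex_balanced_sarkaria:
  fixes w :: "('a::euclidean_space \<times> real) \<times> nat \<Rightarrow> real"
  assumes "r > 0"
  shows "\<exists>G. (\<Sum>j\<in>{1..r}. G j) = 0 \<and>
    (\<forall>j\<in>{1..r}. \<forall>x. (\<Sum>k\<in>sarkaria_index r. w k * sarkaria r (j, x) k) = G j \<bullet> (x, 1::real))"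
proof -
  define W where "W l = (\<Sum>b\<in>Basis. w (b, l) *\<^sub>R b)" for l
  define G where "G = W(r := - (\<Sum>l\<in>{1..<r}. W l))"
  have "{1..r} = insert r {1..<r}" using assms by auto
  then have G: "(\<Sum>j\<in>{1..r}. G j) = 0" by (simp add: G_def)
  have w: "w k = G (snd k) \<bullet> fst k" if "k \<in> sarkaria_index r" for k
    using that by (auto simp: sarkaria_index_def G_def W_def)
  have "(\<Sum>k\<in>sarkaria_index r. w k * sarkaria r p k)
      = (\<Sum>k\<in>sarkaria_index r. (G (snd k) \<bullet> fst k) * sarkaria r p k)" for p
    by (intro sum.cong) (auto simp: w)
  then show ?thesis
    using sum_sarkaria_balanced[OF G] G by (intro exI[of _ G]) auto
qed

lemma card_halfspace_dichotomies:
  fixes X :: "'a::euclidean_space set"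
  assumes "finite X"
  shows "card ((\<lambda>G. {p \<in> {1..r} \<times> X. G (fst p) \<bullet> (snd p, 1::real) > 0}) ` {G. (\<Sum>j\<in>{1..r}. G j) = 0})
       \<le> (\<Sum>i\<le>(DIM('a) + 1) * (r - 1). (r * card X) choose i)" (is "card (?f ` ?B) \<le> _")
proof -
  let ?F = "\<lambda>w. {p \<in> {1..r} \<times> X. (\<Sum>k\<in>sarkaria_index r. w k * sarkaria r p k) > 0}"
  have "?f ` ?B \<subseteq> range ?F"
  proof
    fix T assume "T \<in> ?f ` ?B"
    then obtain G where G: "(\<Sum>j\<in>{1..r}. G j) = 0" "T = ?f G" by blast
    then have "T = ?F (\<lambda>k. G (snd k) \<bullet> fst k)"
      using sum_sarkaria_balanced[OF G(1)] by auto
    then show "T \<in> range ?F" by (rule range_eqI[where f = ?F and x = "\<lambda>k. G (snd k) \<bullet> fst k"])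
  qed
  moreover have "finite (range ?F)"
    by (rule finite_subset[of _ "Pow ({1..r} \<times> X)"]) (use assms in auto)
  ultimately have "card (?f ` ?B) \<le> card (range ?F)" by (rule card_mono[rotated])
  also have "\<dots> \<le> (\<Sum>i\<le>card (sarkaria_index r :: (('a \<times> real) \<times> nat) set). card ({1..r} \<times> X) choose i)"
    by (rule card_linear_dichotomies) (use assms in auto)
  finally show ?thesis by (simp add: card_sarkaria_index card_cartesian_product)
qed

text \<open>Gordan's alternative for the tensors of all pairs \<open>(j, x)\<close> with
  \<open>x\<close> in \<open>A j\<close>. A solution is the separating family; a dependence would
  produce a common point of the hulls.\<close>

lemma balanced_separation:
  fixes A :: "nat \<Rightarrow> 'a::euclidean_space set"
  assumes "r > 0" and fin: "\<And>j. j \<in> {1..r} \<Longrightarrow> finite (A j)"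
    and disj: "(\<Inter>j\<in>{1..r}. convex hull A j) = {}"
  shows "\<exists>G. (\<Sum>j\<in>{1..r}. G j) = 0 \<and> (\<forall>j\<in>{1..r}. \<forall>x\<in>A j. G j \<bullet> (x, 1::real) > 0)"
proof -
  define Q where "Q = Sigma {1..r} A"
  have finQ: "finite Q" unfolding Q_def by (intro finite_SigmaI fin) auto
  have "\<exists>w. \<forall>p\<in>Q. (\<Sum>k\<in>sarkaria_index r. w k * sarkaria r p k) > 0"
    using gordan_alternative[OF finite_sarkaria_index[of r] finQ, where y = "sarkaria r"]
  proof (elim disjE exE conjE)
    fix c assume "\<forall>p\<in>Q. 0 \<le> c p" and c_pos: "\<exists>p\<in>Q. 0 < c p"
      and "\<forall>k\<in>sarkaria_index r. (\<Sum>p\<in>Q. c p * sarkaria r p k) = 0"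
    then have c: "\<And>p. p \<in> Q \<Longrightarrow> c p \<ge> 0"
        "\<And>k. k \<in> sarkaria_index r \<Longrightarrow> (\<Sum>p\<in>Q. c p * sarkaria r p k) = 0" by auto
    \<comment> \<open>First component: weighted sum of the points of \<open>A j\<close>; second
      component: total weight. Coordinate \<open>(b, l)\<close> of the dependence says that
      \<open>s l\<close> and \<open>s r\<close> agree along \<open>b\<close>.\<close>
    define s where "s j = (\<Sum>x\<in>A j. c (j, x) *\<^sub>R (x, 1::real))" for j
    have rr: "r \<in> {1..r}" using assms by simp
    have s_eq: "s l = s r" if l: "l \<in> {1..<r}" for l
    proof (rule euclidean_eqI)
      fix b :: "'a \<times> real" assume b: "b \<in> Basis"
      have "0 = (\<Sum>p\<in>Q. c p * sarkaria r p (b, l))"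
        using b l c(2) by (simp add: sarkaria_index_def)
      also have "\<dots> = (\<Sum>j\<in>{1..r}. \<Sum>x\<in>A j. c (j, x) * sarkaria r (j, x) (b, l))"
        unfolding Q_def using fin by (subst sum.Sigma) (auto simp: case_prod_unfold)
      also have "\<dots> = (\<Sum>j\<in>{1..r}. (if j = l then 1 else if j = r then - 1 else 0) * (s j \<bullet> b))"
        by (simp add: s_def sarkaria_Pair inner_sum_left sum_distrib_left mult_ac inner_commute[of b] del: scaleR_Pair)
      also have "\<dots> = (\<Sum>j\<in>{1..r}. (if j = l then s l \<bullet> b else 0) - (if j = r then s r \<bullet> b else 0))"
        using l by (intro sum.cong) auto
      also have "\<dots> = s l \<bullet> b - s r \<bullet> b"
        using l rr by (simp add: sum_subtractf)
      finally show "s l \<bullet> b = s r \<bullet> b" by simp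
    qed
    then have s_eq: "s j = s r" if "j \<in> {1..r}" for j
      using that by (cases "j = r") auto
    have snd_s: "snd (s j) = (\<Sum>x\<in>A j. c (j, x))" for j by (simp add: s_def snd_sum)
    have fst_s: "fst (s j) = (\<Sum>x\<in>A j. c (j, x) *\<^sub>R x)" for j by (simp add: s_def fst_sum)
    obtain j x where "j \<in> {1..r}" "x \<in> A j" "c (j, x) > 0" using c_pos by (auto simp: Q_def)
    then have "snd (s j) > 0" unfolding snd_s
      using fin c(1) by (intro sum_pos2[of _ x]) (auto simp: Q_def)
    then have m: "snd (s r) > 0" using s_eq[OF \<open>j \<in> {1..r}\<close>] by simp
    define m where "m = snd (s r)"
    \<comment> \<open>All parts have the same positive total weight \<open>m\<close> and the same
      weighted sum, so normalizing gives one point that is a convex combination in each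
      part.\<close>
    have "inverse m *\<^sub>R fst (s r) \<in> convex hull A j" if j: "j \<in> {1..r}" for j
    proof -
      have "(\<Sum>x\<in>A j. c (j, x) / m) = 1"
        using m s_eq[OF j] by (simp add: sum_divide_distrib[symmetric] snd_s[symmetric] m_def)
      moreover have "(\<Sum>x\<in>A j. (c (j, x) / m) *\<^sub>R x) = inverse m *\<^sub>R fst (s r)"
        unfolding s_eq[OF j, symmetric] fst_s scaleR_sum_right by (simp add: field_simps)
      moreover have "\<forall>x\<in>A j. c (j, x) / m \<ge> 0"
        using c(1) j m by (auto simp: Q_def m_def)
      ultimately show ?thesis
        unfolding convex_hull_finite[OF fin[OF j]] by (intro CollectI exI[of _ "\<lambda>x. c (j, x) / m"]) auto
    qed
    then show ?thesis using disj by blast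
  qed blast
  then obtain w where w: "\<And>p. p \<in> Q \<Longrightarrow> (\<Sum>k\<in>sarkaria_index r. w k * sarkaria r p k) > 0" by blast
  from ex_balanced_sarkaria[OF assms(1), of w] obtain G where
    "(\<Sum>j\<in>{1..r}. G j) = 0"
    "\<forall>j\<in>{1..r}. \<forall>x. (\<Sum>k\<in>sarkaria_index r. w k * sarkaria r (j, x) k) = G j \<bullet> (x, 1::real)" by blast
  moreover from this w have "\<forall>j\<in>{1..r}. \<forall>x\<in>A j. G j \<bullet> (x, 1) > 0"
    by (auto simp: Q_def)
  ultimately show ?thesis by blast
qed

text \<open>Half-spaces need nonzero normals. Not all normals vanish, since constants positive on
  nonempty sets cannot sum to zero; a small multiple of one nonzero normal then repairs the
  others.\<close>

lemma balanced_separation_nonzero: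
  fixes A :: "nat \<Rightarrow> 'a::euclidean_space set"
  assumes "r > 0" and fin: "\<And>j. j \<in> {1..r} \<Longrightarrow> finite (A j)"
    and ne: "\<And>j. j \<in> {1..r} \<Longrightarrow> A j \<noteq> {}"
    and disj: "(\<Inter>j\<in>{1..r}. convex hull A j) = {}"
  shows "\<exists>G. (\<Sum>j\<in>{1..r}. G j) = 0 \<and> (\<forall>j\<in>{1..r}. fst (G j) \<noteq> 0) \<and>
    (\<forall>j\<in>{1..r}. \<forall>x\<in>A j. G j \<bullet> (x, 1::real) > 0)"
proof -
  have "\<exists>G. (\<Sum>j\<in>{1..r}. G j) = 0 \<and> (\<forall>j\<in>{1..r}. \<forall>x\<in>A j. G j \<bullet> (x, 1::real) > 0)"
    by (rule balanced_separation) (use assms in auto)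
  then obtain G where
    G: "(\<Sum>j\<in>{1..r}. G j) = 0" "\<And>j x. j \<in> {1..r} \<Longrightarrow> x \<in> A j \<Longrightarrow> G j \<bullet> (x, 1::real) > 0" by blast
  have "\<exists>k\<in>{1..r}. fst (G k) \<noteq> 0"
  proof (rule ccontr)
    assume z: "\<not> ?thesis"
    have "snd (G j) > 0" if j: "j \<in> {1..r}" for j
      using G(2)[OF j] ne[OF j] z j by (auto simp: inner_prod_def)
    then have "(\<Sum>j\<in>{1..r}. snd (G j)) > 0" using assms(1) by (intro sum_pos) auto
    then show False using G(1) by (simp flip: snd_sum)
  qed
  then obtain k where k: "k \<in> {1..r}" "fst (G k) \<noteq> 0" by blast
  define Z where "Z = {j \<in> {1..r}. fst (G j) = 0}"
  \<comment> \<open>The weights sum to zero: what the functions with zero normal receive is taken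
    from the \<open>k\<close>-th, so balance is preserved.\<close>
  define e where "e j = (if j = k then - real (card Z) else if j \<in> Z then 1 else 0)" for j
  have kZ: "k \<notin> Z" "finite Z" using k by (auto simp: Z_def)
  have "(\<Sum>j\<in>{1..r}. e j) = - real (card Z) + (\<Sum>j\<in>{1..r} - {k}. if j \<in> Z then 1 else 0)"
    using k by (subst sum.remove[of _ k]) (auto simp: e_def intro!: sum.cong)
  also have "(\<Sum>j\<in>{1..r} - {k}. if j \<in> Z then 1 else 0) = (\<Sum>j\<in>Z. 1::real)"
    using kZ by (intro sum.mono_neutral_cong_right) (auto simp: Z_def)
  finally have e_sum: "(\<Sum>j\<in>{1..r}. e j) = 0" by simp
  define D where "D = (fst (G k), 0::real)"
  \<comment> \<open>The condition over a singleton puts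
    \<open>1 - \<epsilon> * real (card Z)\<close> into the form of the perturbation lemma; its
    positivity keeps the \<open>k\<close>-th normal nonzero.\<close>
  have "\<forall>\<^sub>F \<epsilon> in at_right 0. (\<forall>p\<in>Sigma {1..r} A. G (fst p) \<bullet> (snd p, 1) +
      \<epsilon> * (e (fst p) * (D \<bullet> (snd p, 1))) > 0) \<and> (\<forall>i\<in>{()}. 1 + \<epsilon> * (- real (card Z)) > 0) \<and> \<epsilon> > 0"
    by (intro eventually_conj eventually_perturbation_pos eventually_at_right_less)
       (use fin G in auto)
  then obtain \<epsilon> where \<epsilon>: "\<And>j x. j \<in> {1..r} \<Longrightarrow> x \<in> A j \<Longrightarrow> G j \<bullet> (x, 1) + \<epsilon> * (e j * (D \<bullet> (x, 1))) > 0"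
      "1 - \<epsilon> * real (card Z) > 0" "\<epsilon> > 0"
    using eventually_happens'[OF trivial_limit_at_right_real] by fastforce
  define G' where "G' j = G j + (\<epsilon> * e j) *\<^sub>R D" for j
  have "(\<Sum>j\<in>{1..r}. G' j) = 0"
    using G e_sum by (simp add: G'_def sum.distrib flip: scaleR_sum_left sum_distrib_left)
  moreover have "fst (G' j) \<noteq> 0" if "j \<in> {1..r}" for j
  proof -
    consider "j = k" | "j \<noteq> k" "j \<in> Z" | "j \<noteq> k" "j \<notin> Z" by blast
    then show ?thesis
    proof cases
      case 1
      then have "fst (G' j) = (1 - \<epsilon> * real (card Z)) *\<^sub>R fst (G k)"
        by (simp add: G'_def e_def D_def algebra_simps)
      then show ?thesis using \<epsilon> k by simp
    qed (use \<epsilon> k that in \<open>auto simp: G'_def e_def D_def Z_def\<close>)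
  qed
  moreover have "G' j \<bullet> (x, 1) > 0" if "j \<in> {1..r}" "x \<in> A j" for j x
    using \<epsilon>(1)[OF that] by (simp add: G'_def inner_add_left)
  ultimately show ?thesis by blast
qed

lemma halfspace_positive:
  fixes g :: "'a::euclidean_space \<times> real"
  assumes "fst g \<noteq> 0"
  shows "halfspace {x. g \<bullet> (x, 1) > 0}"
proof -
  have "{x. g \<bullet> (x, 1) > 0} = {x. (- fst g) \<bullet> x < snd g}"
    by (auto simp: inner_prod_def)
  then show ?thesis unfolding halfspace_def using assms by (metis neg_equal_0_iff_equal)
qed

text \<open>The values at any point sum to zero, so they cannot all be positive.\<close>

lemma balanced_halfspaces_disjoint:
  fixes G :: "nat \<Rightarrow> 'a::euclidean_space \<times> real"
  assumes "r > 0" "(\<Sum>j\<in>{1..r}. G j) = 0"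
  shows "(\<Inter>j\<in>{1..r}. {x. G j \<bullet> (x, 1) > 0}) = {}"
proof -
  have False if "\<And>j. j \<in> {1..r} \<Longrightarrow> G j \<bullet> (x, 1) > 0" for x
  proof -
    have "(\<Sum>j\<in>{1..r}. G j \<bullet> (x, 1)) > 0" using that assms by (intro sum_pos) auto
    then show False using assms by (simp flip: inner_sum_left)
  qed
  then show ?thesis by blast
qed

lemma convex_halfspace: "halfspace H \<Longrightarrow> convex H"
  unfolding halfspace_def by (auto simp: convex_halfspace_le convex_halfspace_lt)

subsection \<open>Splitting and labelling\<close>

lemma ex_halfspace: "\<exists>H :: 'a::euclidean_space set. halfspace H"
  unfolding halfspace_def using nonempty_Basis nonzero_Basis by blast

text \<open>There may be infinitely many families of half-spaces, but the counts are bounded by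
  \<open>card \<C>\<close>, so \<open>Max\<close> is taken over a finite nonempty set.\<close>

lemma
  fixes \<C> :: "'a::euclidean_space set set"
  assumes "finite \<C>"
  shows card_splits_le_max_split:
      "(\<And>i. i \<in> {1..r} \<Longrightarrow> halfspace (H i)) \<Longrightarrow> card {C \<in> \<C>. splits r H C} \<le> max_split r \<C>"
    and max_split_attained:
      "\<exists>H. (\<forall>i\<in>{1..r}. halfspace (H i)) \<and> card {C \<in> \<C>. splits r H C} = max_split r \<C>"
proof -
  define V where "V = {card {C \<in> \<C>. splits r H C} |H. \<forall>i\<in>{1..r}. halfspace (H i)}"
  have "V \<subseteq> {..card \<C>}" unfolding V_def using assms by (auto intro: card_mono)
  then have fin: "finite V" by (rule finite_subset) simp
  have max: "max_split r \<C> = Max V" by (simp add: max_split_def V_def)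
  obtain H0 :: "'a set" where "halfspace H0" using ex_halfspace by blast
  then have "card {C \<in> \<C>. splits r (\<lambda>_. H0) C} \<in> V" unfolding V_def by blast
  then have "Max V \<in> V" using fin by (intro Max_in) auto
  moreover have "\<exists>H. (\<forall>i\<in>{1..r}. halfspace (H i)) \<and> card {C \<in> \<C>. splits r H C} = v" if "v \<in> V" for v
    using that by (auto simp: V_def)
  ultimately show "\<exists>H. (\<forall>i\<in>{1..r}. halfspace (H i)) \<and> card {C \<in> \<C>. splits r H C} = max_split r \<C>"
    unfolding max by blast
  show "card {C \<in> \<C>. splits r H C} \<le> max_split r \<C>" if "\<And>i. i \<in> {1..r} \<Longrightarrow> halfspace (H i)"
    unfolding max by (rule Max_ge[OF fin]) (use that in \<open>auto simp: V_def\<close>)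
qed

text \<open>The second splitting condition is Hall's condition for the sets
  \<open>C \<inter> H i\<close>.\<close>

lemma splits_imp_labelling:
  assumes "splits r H C" "finite C"
  shows "\<exists>f. inj_on f {1..r} \<and> (\<forall>i\<in>{1..r}. f i \<in> C \<inter> H i)"
proof (rule hall_marriage)
  fix J assume J: "J \<subseteq> {1..r}"
  show "card J \<le> card (\<Union>i\<in>J. C \<inter> H i)"
  proof (cases "J = {}")
    case False
    have "finite J" using J by (rule finite_subset) simp
    then have "card J \<in> {1..r}" using J False card_mono[OF _ J] by (auto simp: Suc_le_eq card_gt_0_iff)
    then have "card J \<le> card (C \<inter> (\<Union>i\<in>J. H i))" using assms J unfolding splits_def by blast
    then show ?thesis by simp
  qed simp
qed (use assms in auto)

lemma labelling_imp_splits: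
  assumes "inj_on f {1..r}" "\<And>i. i \<in> {1..r} \<Longrightarrow> f i \<in> C \<inter> H i" "finite C" "(\<Inter>i\<in>{1..r}. H i) = {}"
  shows "splits r H C"
  unfolding splits_def
proof (intro conjI ballI allI impI)
  fix k J assume J: "J \<subseteq> {1..r}" "card J = k"
  have "f ` J \<subseteq> C \<inter> (\<Union>i\<in>J. H i)" using J assms(2) by blast
  then have "card J \<le> card (C \<inter> (\<Union>i\<in>J. H i))"
    using assms(1,3) J by (intro card_inj_on_le[of f]) (auto intro: inj_on_subset)
  then show "k \<le> card (C \<inter> (\<Union>i\<in>J. H i))" using J by simp
qed fact

text \<open>Keep only split classes that need the same permutation of the parts. Each remaining
  part, and by convexity its hull, then lies in its own half-space, and the half-spaces have no
  common point.\<close>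

lemma colorful_removal:
  fixes \<C> :: "'a::euclidean_space set set"
  assumes "finite \<C>" and card: "\<And>C. C \<in> \<C> \<Longrightarrow> card C = r" and "r > 0"
    and P: "colorful_partition r \<C> P"
    and H: "\<And>i. i \<in> {1..r} \<Longrightarrow> halfspace (H i)"
    and ne: "{C \<in> \<C>. splits r H C} \<noteq> {}"
  shows "\<exists>S\<subseteq>\<C>. real (card S) \<le> real (card \<C>) - 1 / fact r * real (card {C \<in> \<C>. splits r H C}) \<and>
    \<not> tverberg (remove_classes S P)"
proof -
  define F where "F = {C \<in> \<C>. splits r H C}"
  have part: "\<Union>P = \<Union>\<C>" "card P = r" and one: "\<And>A C. A \<in> P \<Longrightarrow> C \<in> \<C> \<Longrightarrow> card (A \<inter> C) = 1"
    using P by (auto simp: colorful_partition_def partition_on_def)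
  have "finite P" using part \<open>r > 0\<close> by (intro card_ge_0_finite) simp
  then obtain e where e: "bij_betw e {1..r} P"
    using part ex_bij_betw_nat_finite_1 by blast
  have eP: "e i \<in> P" if "i \<in> {1..r}" for i using e that by (auto simp: bij_betw_def)
  have "\<exists>\<pi>. \<pi> permutes {1..r} \<and> (\<forall>i\<in>{1..r}. e (\<pi> i) \<inter> C \<subseteq> H i)" if C: "C \<in> F" for C
  proof -
    have C': "C \<in> \<C>" "splits r H C" using C by (auto simp: F_def)
    have "finite C" using card[OF C'(1)] \<open>r > 0\<close> by (intro card_ge_0_finite) simp
    from splits_imp_labelling[OF C'(2) this] obtain f where
      f: "inj_on f {1..r}" "\<And>i. i \<in> {1..r} \<Longrightarrow> f i \<in> C \<inter> H i" by blast
    have "\<exists>j\<in>{1..r}. f i \<in> e j" if "i \<in> {1..r}" for i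
    proof -
      have "f i \<in> \<Union>P" using f(2)[OF that] C'(1) part by auto
      then show ?thesis using e by (auto simp: bij_betw_def)
    qed
    \<comment> \<open>\<open>\<rho> i\<close> is the part containing the label \<open>f i\<close>. A
      part holds only one point of \<open>C\<close>, so distinct labels lie in distinct parts and
      \<open>\<rho>\<close> is a permutation.\<close>
    then obtain \<rho> where \<rho>: "\<And>i. i \<in> {1..r} \<Longrightarrow> \<rho> i \<in> {1..r}" "\<And>i. i \<in> {1..r} \<Longrightarrow> f i \<in> e (\<rho> i)"
      by metis
    have single: "e (\<rho> i) \<inter> C = {f i}" if i: "i \<in> {1..r}" for i
    proof -
      obtain x where "e (\<rho> i) \<inter> C = {x}"
        using one[OF eP[OF \<rho>(1)[OF i]] C'(1)] by (auto simp: card_1_singleton_iff)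
      then show ?thesis using \<rho>(2)[OF i] f(2)[OF i] by auto
    qed
    have "inj_on \<rho> {1..r}"
    proof (rule inj_onI)
      fix i j assume ij: "i \<in> {1..r}" "j \<in> {1..r}" "\<rho> i = \<rho> j"
      then have "{f i} = {f j}" using single by metis
      then show "i = j" using ij f(1) by (simp add: inj_on_eq_iff)
    qed
    then have "bij_betw \<rho> {1..r} {1..r}"
      using \<rho>(1) by (simp add: bij_betw_def endo_inj_surj image_subset_iff)
    define \<pi> where "\<pi> i = (if i \<in> {1..r} then \<rho> i else i)" for i
    have "bij_betw \<pi> {1..r} {1..r}"
      using \<open>bij_betw \<rho> {1..r} {1..r}\<close> by (rule iffD1[OF bij_betw_cong, rotated]) (simp add: \<pi>_def)
    then have "\<pi> permutes {1..r}" by (rule bij_imp_permutes) (auto simp: \<pi>_def)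
    moreover have "\<forall>i\<in>{1..r}. e (\<pi> i) \<inter> C \<subseteq> H i"
      using single f(2) by (auto simp: \<pi>_def)
    ultimately show ?thesis by blast
  qed
  then obtain \<pi> where \<pi>: "\<And>C. C \<in> F \<Longrightarrow> \<pi> C permutes {1..r}"
    "\<And>C i. C \<in> F \<Longrightarrow> i \<in> {1..r} \<Longrightarrow> e (\<pi> C i) \<inter> C \<subseteq> H i" by metis
  define perms where "perms = {\<sigma>. \<sigma> permutes {1..r}}"
  have perms: "finite perms" "card perms = fact r"
    by (simp_all add: perms_def card_permutations finite_permutations)
  have perms_ne: "perms \<noteq> {}" using permutes_id unfolding perms_def by blast
  \<comment> \<open>Pigeonhole over the \<open>fact r\<close> permutations.\<close>
  have "\<exists>\<sigma>\<in>perms. real (card {C \<in> F. \<pi> C = \<sigma>}) \<ge> card F / fact r"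
  proof (rule ccontr)
    assume "\<not> ?thesis"
    then have "real (card {C \<in> F. \<pi> C = \<sigma>}) < card F / fact r" if "\<sigma> \<in> perms" for \<sigma>
      using that by (meson not_le)
    then have "(\<Sum>\<sigma>\<in>perms. real (card {C \<in> F. \<pi> C = \<sigma>})) < (\<Sum>\<sigma>\<in>perms. card F / fact r)"
      by (rule sum_strict_mono[OF perms(1) perms_ne])
    also have "\<dots> = card F" by (simp add: perms)
    also have "F = (\<Union>\<sigma>\<in>perms. {C \<in> F. \<pi> C = \<sigma>})" using \<pi>(1) by (auto simp: perms_def)
    then have "card F \<le> (\<Sum>\<sigma>\<in>perms. card {C \<in> F. \<pi> C = \<sigma>})"
      using card_UN_le[OF perms(1)] by metis
    finally show False by simp
  qed
  then obtain \<sigma> where \<sigma>: "\<sigma> permutes {1..r}" "real (card {C \<in> F. \<pi> C = \<sigma>}) \<ge> card F / fact r"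
    by (auto simp: perms_def)
  define R where "R = {C \<in> F. \<pi> C = \<sigma>}"
  have R: "R \<subseteq> \<C>" by (auto simp: R_def F_def)
  have "real (card (\<C> - R)) = real (card \<C>) - real (card R)"
    using R assms(1) by (simp add: card_Diff_subset finite_subset card_mono of_nat_diff)
  moreover have "(\<Inter>A\<in>remove_classes (\<C> - R) P. convex hull A) \<subseteq> (\<Inter>i\<in>{1..r}. H i)"
  proof
    fix x assume x: "x \<in> (\<Inter>A\<in>remove_classes (\<C> - R) P. convex hull A)"
    have "x \<in> H i" if i: "i \<in> {1..r}" for i
    proof -
      have \<sigma>i: "\<sigma> i \<in> {1..r}" using permutes_in_image[OF \<sigma>(1)] i by blast
      have "e (\<sigma> i) - \<Union>(\<C> - R) \<subseteq> H i"
      proof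
        fix z assume z: "z \<in> e (\<sigma> i) - \<Union>(\<C> - R)"
        then have "z \<in> \<Union>\<C>" using eP[OF \<sigma>i] part by auto
        then obtain C where "C \<in> R" "z \<in> C" using z by auto
        then show "z \<in> H i" using \<pi>(2)[of C i] i z by (auto simp: R_def)
      qed
      then have "convex hull (e (\<sigma> i) - \<Union>(\<C> - R)) \<subseteq> H i"
        by (rule hull_minimal) (use H[OF i] convex_halfspace in auto)
      then show ?thesis using x eP[OF \<sigma>i] by (auto simp: remove_classes_def)
    qed
    then show "x \<in> (\<Inter>i\<in>{1..r}. H i)" by blast
  qed
  moreover have "(\<Inter>i\<in>{1..r}. H i) = {}" using ne by (auto simp: splits_def)
  ultimately have "\<not> tverberg (remove_classes (\<C> - R) P)" unfolding tverberg_def by simp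
  then show ?thesis
    using \<sigma>(2) \<open>real (card (\<C> - R)) = _\<close> unfolding F_def[symmetric] R_def[symmetric]
    by (intro exI[of _ "\<C> - R"]) auto
qed

text \<open>Disjoint classes make the class of a point unique, and bijectivity its index. Since
  \<open>\<C>\<close> is nonempty, the parts are nonempty and hence distinct, so there are exactly
  \<open>r\<close>.\<close>

lemma colorful_partition_of_bijections:
  fixes a :: "'a set \<Rightarrow> nat \<Rightarrow> 'a"
  assumes "\<C> \<noteq> {}" "disjoint \<C>" and bij: "\<And>C. C \<in> \<C> \<Longrightarrow> bij_betw (a C) {1..r} C"
  shows "colorful_partition r \<C> ((\<lambda>j. (\<lambda>C. a C j) ` \<C>) ` {1..r})"
proof -
  define A where "A j = (\<lambda>C. a C j) ` \<C>" for j
  have in_class: "a C j \<in> C" if "C \<in> \<C>" "j \<in> {1..r}" for C j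
    using bij[OF that(1)] that(2) by (auto simp: bij_betw_def)
  have class_eq: "C = D" if "C \<in> \<C>" "D \<in> \<C>" "x \<in> C" "x \<in> D" for C D x
    using assms(2) that by (auto simp: disjoint_def)
  have inter: "A j \<inter> C = {a C j}" if C: "C \<in> \<C>" and j: "j \<in> {1..r}" for C j
  proof (intro equalityI subsetI)
    fix x assume x: "x \<in> A j \<inter> C"
    then obtain D where D: "D \<in> \<C>" "x = a D j" by (auto simp: A_def)
    then have "D = C" using class_eq[of D C x] in_class[of D j] C j x by auto
    then show "x \<in> {a C j}" using D by simp
  qed (use in_class[OF C j] C in \<open>auto simp: A_def\<close>)
  have eq: "i = j" if ij: "i \<in> {1..r}" "j \<in> {1..r}" "x \<in> A i" "x \<in> A j" for i j x
  proof -
    obtain C where C: "C \<in> \<C>" "x = a C i" using ij(3) by (auto simp: A_def)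
    then have "x \<in> A j \<inter> C" using that in_class by auto
    then have "x = a C j" unfolding inter[OF C(1) ij(2)] by (rule singletonD)
    with C(2) have "a C i = a C j" by (rule subst)
    moreover have "inj_on (a C) {1..r}" using bij[OF C(1)] by (rule bij_betw_imp_inj_on)
    ultimately show ?thesis using ij(1,2) inj_onD by metis
  qed
  have ne: "A j \<noteq> {}" for j using assms(1) by (simp add: A_def)
  have "partition_on (\<Union>\<C>) (A ` {1..r})"
  proof (rule partition_onI)
    show "\<Union>(A ` {1..r}) = \<Union>\<C>"
    proof (intro equalityI subsetI)
      fix x assume "x \<in> \<Union>\<C>"
      then obtain C where C: "C \<in> \<C>" "x \<in> C" by blast
      then obtain j where "j \<in> {1..r}" "x = a C j"
        using bij_betw_imp_surj_on[OF bij[OF C(1)]] by blast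
      then show "x \<in> \<Union>(A ` {1..r})" using C by (auto simp: A_def)
    next
      fix x assume "x \<in> \<Union>(A ` {1..r})"
      then obtain j C where "j \<in> {1..r}" "C \<in> \<C>" "x = a C j" unfolding A_def by blast
      then show "x \<in> \<Union>\<C>" using in_class by blast
    qed
    fix p q assume "p \<in> A ` {1..r}" "q \<in> A ` {1..r}" "p \<noteq> q"
    then obtain i j where "p = A i" "q = A j" "i \<in> {1..r}" "j \<in> {1..r}" "i \<noteq> j" by blast
    then show "disjnt p q" using eq[of i j] unfolding disjnt_iff by blast
  qed (use ne in auto)
  moreover have "inj_on A {1..r}" using eq ne by (metis ex_in_conv inj_onI)
  then have "card (A ` {1..r}) = r" by (simp add: card_image)
  moreover have "\<forall>p\<in>A ` {1..r}. \<forall>C\<in>\<C>. card (p \<inter> C) = 1" using inter by auto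
  ultimately show ?thesis unfolding colorful_partition_def A_def by simp
qed

subsection \<open>Random labellings\<close>

text \<open>Each \<open>e i\<close> misses some half-space \<open>H (g i)\<close>, so a successful
  permutation satisfies \<open>g (\<pi> j) \<noteq> j\<close> throughout; derangements bound the
  number of these.\<close>

lemma prob_labelling_le:
  assumes e: "bij_betw e {1..r} C" and H: "(\<Inter>j\<in>{1..r}. H j) = {}"
  shows "measure_pmf.prob (pmf_of_set {\<pi>. \<pi> permutes {1..r}}) {\<pi>. \<forall>j\<in>{1..r}. e (\<pi> j) \<in> H j}
     \<le> 1 - fixpoint_prob r"
proof -
  let ?S = "{\<pi>. \<pi> permutes {1..r}}"
  have S: "finite ?S" "?S \<noteq> {}" using permutes_id by (auto simp: finite_permutations simp del: permutes_id)
  have "\<forall>i. \<exists>j. j \<in> {1..r} \<and> e i \<notin> H j" using H by blast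
  then obtain g where g: "\<And>i. g i \<in> {1..r}" "\<And>i. e i \<notin> H (g i)" by metis
  have "g (\<pi> j) \<noteq> j" if "e (\<pi> j) \<in> H j" for \<pi> j using g(2)[of "\<pi> j"] that by auto
  then have "card (?S \<inter> {\<pi>. \<forall>j\<in>{1..r}. e (\<pi> j) \<in> H j})
      \<le> card {\<pi>. \<pi> permutes {1..r} \<and> (\<forall>j\<in>{1..r}. g (\<pi> j) \<noteq> j)}"
    by (intro card_mono rev_finite_subset[OF S(1)]) auto
  also have "\<dots> \<le> card {\<pi>. \<pi> permutes {1..r} \<and> (\<forall>j\<in>{1..r}. \<pi> j \<noteq> j)}"
    by (rule card_permutes_avoiding_le) (use g in auto)
  also have "{\<pi>. \<pi> permutes {1..r} \<and> (\<forall>j\<in>{1..r}. \<pi> j \<noteq> j)} = ?S \<inter> (- {\<pi>. \<exists>j\<in>{1..r}. \<pi> j = j})"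
    by auto
  finally have "measure_pmf.prob (pmf_of_set ?S) {\<pi>. \<forall>j\<in>{1..r}. e (\<pi> j) \<in> H j}
      \<le> measure_pmf.prob (pmf_of_set ?S) (- {\<pi>. \<exists>j\<in>{1..r}. \<pi> j = j})"
    using S by (simp add: measure_pmf_of_set divide_right_mono)
  also have "\<dots> = 1 - fixpoint_prob r"
    unfolding fixpoint_prob_def by (subst measure_pmf.prob_compl[symmetric]) (auto simp: Compl_eq_Diff_UNIV)
  finally show ?thesis .
qed

text \<open>Hoeffding's inequality for independent indicators. The number \<open>m\<close> only
  bounds \<open>card F\<close>, so that one threshold and one tail bound serve all sign
  patterns.\<close>

lemma prob_count_ge_le:
  fixes U :: "'c pmf" and D :: "'b \<Rightarrow> 'c set" and q \<epsilon> m :: real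
  assumes "finite I" "F \<subseteq> I" "real (card F) \<le> m" "\<epsilon> > 0" "q \<ge> 0"
    and q: "\<And>i. i \<in> F \<Longrightarrow> measure_pmf.prob U (D i) \<le> q"
  shows "measure_pmf.prob (Pi_pmf I d (\<lambda>_. U)) {\<omega>. real (card {i \<in> F. \<omega> i \<in> D i}) \<ge> q * m + \<epsilon>}
    \<le> exp (- 2 * \<epsilon>\<^sup>2 / m)"
proof (cases "F = {}")
  case True
  \<comment> \<open>The count is 0 and the threshold positive. This case is separate because the sum
    of squared ranges in Hoeffding's bound would vanish.\<close>
  then have "q * m \<ge> 0" using assms by simp
  then have "{\<omega>. real (card {i \<in> F. \<omega> i \<in> D i}) \<ge> q * m + \<epsilon>} = {}"
    using True \<open>\<epsilon> > 0\<close> by auto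
  then show ?thesis by simp
next
  case False
  let ?M = "Pi_pmf I d (\<lambda>_. U)"
  let ?X = "\<lambda>i \<omega>. indicator (D i) (\<omega> i) :: real"
  have finF: "finite F" using assms finite_subset by blast
  then have F0: "card F > 0" using False by (simp add: card_gt_0_iff)
  have "prob_space.indep_vars (measure_pmf ?M) (\<lambda>_. count_space UNIV) (\<lambda>x f. f x) F"
    by (rule prob_space.indep_vars_subset[OF measure_pmf.prob_space_axioms indep_vars_Pi_pmf[OF assms(1)] assms(2)])
  then have indep: "prob_space.indep_vars (measure_pmf ?M) (\<lambda>_. borel) ?X F"
    by (rule prob_space.indep_vars_compose2[OF measure_pmf.prob_space_axioms]) simp
  interpret Hoeffding_ineq "measure_pmf ?M" F ?X "\<lambda>_. 0" "\<lambda>_. 1"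
    "\<Sum>i\<in>F. measure_pmf.expectation ?M (?X i)"
  proof unfold_locales
    show "prob_space.indep_vars (measure_pmf ?M) (\<lambda>_. borel) ?X F" by (rule indep)
  qed (use finF in \<open>auto simp: indicator_def\<close>)
  have exp_X: "measure_pmf.expectation ?M (?X i) = measure_pmf.prob U (D i)" if "i \<in> F" for i
  proof -
    have "measure_pmf.expectation ?M (?X i) = measure_pmf.expectation (map_pmf (\<lambda>\<omega>. \<omega> i) ?M) (indicator (D i))"
      by (rule integral_map_pmf[symmetric])
    also have "map_pmf (\<lambda>\<omega>. \<omega> i) ?M = U" using that assms by (subst Pi_pmf_component) auto
    finally show ?thesis by simp
  qed
  have "(\<Sum>i\<in>F. measure_pmf.expectation ?M (?X i)) \<le> (\<Sum>i\<in>F. q)"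
    by (intro sum_mono) (use exp_X q in auto)
  also have "\<dots> = q * card F" by simp
  also have "\<dots> \<le> q * m" using assms by (intro mult_left_mono) auto
  finally have mu: "(\<Sum>i\<in>F. measure_pmf.expectation ?M (?X i)) \<le> q * m" .
  have cnt: "real (card {i \<in> F. \<omega> i \<in> D i}) = (\<Sum>i\<in>F. ?X i \<omega>)" for \<omega>
  proof -
    have "(\<Sum>i\<in>F. ?X i \<omega>) = (\<Sum>i\<in>{i \<in> F. \<omega> i \<in> D i}. 1)"
      using finF by (intro sum.mono_neutral_cong_right) auto
    then show ?thesis by simp
  qed
  have "measure_pmf.prob ?M {\<omega>. real (card {i \<in> F. \<omega> i \<in> D i}) \<ge> q * m + \<epsilon>} \<le>
      measure_pmf.prob ?M {\<omega> \<in> space (measure_pmf ?M). (\<Sum>i\<in>F. ?X i \<omega>) \<ge>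
        (\<Sum>i\<in>F. measure_pmf.expectation ?M (?X i)) + \<epsilon>}"
    by (rule measure_pmf.finite_measure_mono) (use mu in \<open>auto simp: cnt\<close>)
  also have "\<dots> \<le> exp (- 2 * \<epsilon>\<^sup>2 / (\<Sum>i\<in>F. (1 - 0)\<^sup>2))"
    by (rule Hoeffding_ineq_ge) (use F0 assms in auto)
  also have "\<dots> \<le> exp (- 2 * \<epsilon>\<^sup>2 / m)"
    using F0 assms by (auto intro!: divide_left_mono mult_pos_pos)
  finally show ?thesis .
qed

text \<open>Union bound over sign patterns instead of the infinitely many families \<open>G\<close>.
  A class counted for \<open>G\<close> is split by the half-spaces of \<open>G\<close>, so at most
  \<open>f\<close> classes are candidates for each pattern.\<close>

lemma ex_robust_labelling:
  fixes \<C> :: "'a::euclidean_space set set" and e :: "'a set \<Rightarrow> nat \<Rightarrow> 'a" and r :: nat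
  defines "q \<equiv> 1 - fixpoint_prob r" and "f \<equiv> real (max_split r \<C>)"
  defines "\<mu> \<equiv> sqrt ((real DIM('a) + 1) * (real r - 1) * f * ln (real (card \<C>) * real r ^ 2) / 2)"
  assumes "finite \<C>" "\<C> \<noteq> {}" "r > 0" and disj: "disjoint \<C>"
    and e: "\<And>C. C \<in> \<C> \<Longrightarrow> bij_betw (e C) {1..r} C"
  shows "\<exists>\<omega>. (\<forall>C\<in>\<C>. \<omega> C permutes {1..r}) \<and>
    (\<forall>G. (\<Sum>j\<in>{1..r}. G j) = 0 \<longrightarrow> (\<forall>j\<in>{1..r}. fst (G j) \<noteq> 0) \<longrightarrow>
      real (card {C \<in> \<C>. \<forall>j\<in>{1..r}. G j \<bullet> (e C (\<omega> C j), 1::real) > 0}) < q * f + (\<mu> + 1))"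
proof -
  define Hs where "Hs G j = {x. G j \<bullet> (x, 1::real) > 0}" for G :: "nat \<Rightarrow> 'a \<times> real" and j :: nat
  define \<G> where "\<G> = {G :: nat \<Rightarrow> 'a \<times> real. (\<Sum>j\<in>{1..r}. G j) = 0 \<and> (\<forall>j\<in>{1..r}. fst (G j) \<noteq> 0)}"
  have finC: "finite C" and cardC: "card C = r" if "C \<in> \<C>" for C
    using bij_betw_finite[OF e[OF that]] bij_betw_same_card[OF e[OF that]] by auto
  have empty: "(\<Inter>j\<in>{1..r}. Hs G j) = {}" if "G \<in> \<G>" for G
    using balanced_halfspaces_disjoint[OF \<open>r > 0\<close>, of G] that by (simp add: \<G>_def Hs_def)
  have split_le: "card {C \<in> \<C>. splits r (Hs G) C} \<le> max_split r \<C>" if "G \<in> \<G>" for G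
    using that by (intro card_splits_le_max_split[OF \<open>finite \<C>\<close>])
      (auto simp: \<G>_def Hs_def intro: halfspace_positive)
  have split: "splits r (Hs G) C"
    if "G \<in> \<G>" and C: "C \<in> \<C>" and \<pi>: "\<pi> permutes {1..r}" and "\<forall>j\<in>{1..r}. e C (\<pi> j) \<in> Hs G j" for G C \<pi>
  proof (rule labelling_imp_splits)
    have "bij_betw (e C \<circ> \<pi>) {1..r} C"
      using permutes_imp_bij[OF \<pi>] e[OF C] by (rule bij_betw_trans)
    then show "inj_on (\<lambda>j. e C (\<pi> j)) {1..r}" by (simp add: bij_betw_def comp_def)
    show "e C (\<pi> i) \<in> C \<inter> Hs G i" if "i \<in> {1..r}" for i
      using that \<open>\<forall>j\<in>{1..r}. _\<close> bij_betwE[OF e[OF C]] permutes_in_image[OF \<pi>, of i] by blast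
  qed (use that finC empty in auto)
  define hit where "hit G \<omega> = {C \<in> \<C>. \<forall>j\<in>{1..r}. e C (\<omega> C j) \<in> Hs G j}" for G and \<omega> :: "'a set \<Rightarrow> nat \<Rightarrow> nat"
  have q0: "q \<ge> 0" by (simp add: q_def fixpoint_prob_def)
  have N1: "real (card \<C>) \<ge> 1" using assms by (simp add: Suc_le_eq card_gt_0_iff)
  have M1: "real (card \<C>) * real r ^ 2 \<ge> 1"
    using mult_mono[OF N1, of 1 "real r ^ 2"] \<open>r > 0\<close> by simp
  have lam0: "\<mu> \<ge> 0" unfolding \<mu>_def using \<open>r > 0\<close> M1
    by (auto intro!: mult_nonneg_nonneg divide_nonneg_pos simp: f_def)
  then have lam1: "\<mu> + 1 > 0" by linarith
  have "\<exists>\<omega>. (\<forall>C\<in>\<C>. \<omega> C permutes {1..r}) \<and> (\<forall>G\<in>\<G>. real (card (hit G \<omega>)) < q * f + (\<mu> + 1))"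
  proof (cases "f = 0")
    case True
    \<comment> \<open>For \<open>f = 0\<close> the tail bound degenerates, but no class can be hit,
      and \<open>\<mu> + 1\<close> is positive.\<close>
    have "real (card (hit G (\<lambda>_. id))) < q * f + (\<mu> + 1)" if G: "G \<in> \<G>" for G
    proof -
      have "hit G (\<lambda>_. id) \<subseteq> {C \<in> \<C>. splits r (Hs G) C}"
        using split[OF G _ permutes_id] by (auto simp: hit_def)
      then have "card (hit G (\<lambda>_. id)) \<le> card {C \<in> \<C>. splits r (Hs G) C}"
        using assms by (intro card_mono) auto
      also have "\<dots> = 0" using split_le[OF G] True by (simp add: f_def)
      finally show ?thesis using True lam0 by simp
    qed
    then show ?thesis by (intro exI[of _ "\<lambda>_. id"]) (simp add: permutes_id)
  next
    case False
    then have f: "f > 0" by (simp add: f_def)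
    \<comment> \<open>For \<open>r = 1\<close> the only half-space would have to be empty and yet
      contain a point. With \<open>r\<close> at least 2, both \<open>n\<close> and \<open>M\<close>
      reach the 2 required by the power bound.\<close>
    have "r \<noteq> 1"
    proof
      assume r: "r = 1"
      have none: "{C \<in> \<C>. splits r H C} = {}" for H
        unfolding splits_def r by (auto simp: Suc_le_eq card_gt_0_iff)
      obtain H where "card {C \<in> \<C>. splits r H C} = max_split r \<C>"
        using max_split_attained[OF \<open>finite \<C>\<close>, of r] by blast
      then show False using f unfolding none by (simp add: f_def)
    qed
    then have r2: "r \<ge> 2" using \<open>r > 0\<close> by simp
    define n where "n = (DIM('a) + 1) * (r - 1)"
    define M where "M = card \<C> * r ^ 2"
    have n2: "n \<ge> 2" unfolding n_def using r2 mult_le_mono[of 2 "DIM('a) + 1" 1 "r - 1"] by simp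
    have "r ^ 2 \<ge> 2 ^ 2" using r2 by (rule power_mono) simp
    then have M2: "M \<ge> 2" unfolding M_def using N1 mult_le_mono[of 1 "card \<C>" 2 "r ^ 2"] by simp
    define X where "X = \<Union>\<C>"
    have finX: "finite X" using assms finC by (auto simp: X_def)
    have "card X = card \<C> * r"
      unfolding X_def using disj finC cardC by (subst card_Union_disjoint) (auto simp: disjoint_def pairwise_def disjnt_def)
    then have MX: "M = r * card X" by (simp add: M_def power2_eq_square)
    define T where "T G = {p \<in> {1..r} \<times> X. G (fst p) \<bullet> (snd p, 1::real) > 0}" for G
    have "card (T ` \<G>) \<le> card (T ` {G. (\<Sum>j\<in>{1..r}. G j) = 0})"
    proof (rule card_mono)
      show "finite (T ` {G. (\<Sum>j\<in>{1..r}. G j) = 0})"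
        by (rule finite_subset[of _ "Pow ({1..r} \<times> X)"]) (use finX in \<open>auto simp: T_def\<close>)
    qed (auto simp: \<G>_def)
    also have "\<dots> \<le> (\<Sum>i\<le>n. M choose i)"
      unfolding T_def[abs_def] n_def MX by (rule card_halfspace_dichotomies[OF finX])
    also have "\<dots> \<le> M ^ n" by (rule sum_choose_le_power[OF M2 n2])
    finally have cardT: "card (T ` \<G>) \<le> M ^ n" .
    have finT: "finite (T ` \<G>)"
      by (rule finite_subset[of _ "Pow ({1..r} \<times> X)"]) (use finX in \<open>auto simp: T_def\<close>)
    define U where "U = pmf_of_set {\<pi>. \<pi> permutes {1..r}}"
    define W where "W = Pi_pmf \<C> id (\<lambda>_. U)"
    \<comment> \<open>The event depends on the pattern only. Requiring permutations makes every
      counted class split, even for \<open>\<omega>\<close> outside the support of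
      \<open>W\<close>.\<close>
    define bad where "bad t = {\<omega>. real (card {C \<in> \<C>. \<omega> C permutes {1..r} \<and> (\<forall>j\<in>{1..r}. (j, e C (\<omega> C j)) \<in> t)})
        \<ge> q * f + (\<mu> + 1)}" for t
    define \<beta> where "\<beta> = exp (- 2 * (\<mu> + 1)\<^sup>2 / f)"
    have bad_le: "measure_pmf.prob W (bad t) \<le> \<beta>" if t: "t \<in> T ` \<G>" for t
    proof -
      obtain G where G: "G \<in> \<G>" "t = T G" using t by blast
      define F where "F = {C \<in> \<C>. splits r (Hs G) C}"
      define D where "D C = {\<pi>. \<forall>j\<in>{1..r}. e C (\<pi> j) \<in> Hs G j}" for C
      have finF: "finite F" using assms by (simp add: F_def)
      have "bad t \<subseteq> {\<omega>. real (card {C \<in> F. \<omega> C \<in> D C}) \<ge> q * f + (\<mu> + 1)}"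
      proof
        fix \<omega> assume \<omega>: "\<omega> \<in> bad t"
        have "{C \<in> \<C>. \<omega> C permutes {1..r} \<and> (\<forall>j\<in>{1..r}. (j, e C (\<omega> C j)) \<in> t)} \<subseteq> {C \<in> F. \<omega> C \<in> D C}"
        proof safe
          fix C assume C: "C \<in> \<C>" "\<omega> C permutes {1..r}" "\<forall>j\<in>{1..r}. (j, e C (\<omega> C j)) \<in> t"
          then have "\<forall>j\<in>{1..r}. e C (\<omega> C j) \<in> Hs G j" by (auto simp: G T_def Hs_def)
          then show "C \<in> F" "\<omega> C \<in> D C" using split[OF G(1) C(1,2)] C by (auto simp: F_def D_def)
        qed
        then have "card {C \<in> \<C>. \<omega> C permutes {1..r} \<and> (\<forall>j\<in>{1..r}. (j, e C (\<omega> C j)) \<in> t)}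
            \<le> card {C \<in> F. \<omega> C \<in> D C}"
          using finF by (intro card_mono) auto
        then show "\<omega> \<in> {\<omega>. real (card {C \<in> F. \<omega> C \<in> D C}) \<ge> q * f + (\<mu> + 1)}"
          using \<omega> by (simp add: bad_def)
      qed
      then have "measure_pmf.prob W (bad t)
          \<le> measure_pmf.prob W {\<omega>. real (card {C \<in> F. \<omega> C \<in> D C}) \<ge> q * f + (\<mu> + 1)}"
        by (intro measure_pmf.finite_measure_mono) auto
      also have "\<dots> \<le> \<beta>"
        unfolding W_def \<beta>_def
      proof (rule prob_count_ge_le)
        show "real (card F) \<le> f" using split_le[OF G(1)] by (simp add: F_def f_def)
        show "measure_pmf.prob U (D C) \<le> q" if "C \<in> F" for C
          unfolding U_def D_def q_def
          by (rule prob_labelling_le[OF e empty[OF G(1)]]) (use that in \<open>simp add: F_def\<close>)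
      qed (use \<open>finite \<C>\<close> q0 lam1 in \<open>auto simp: F_def\<close>)
      finally show ?thesis .
    qed
    have beta: "real (M ^ n) * \<beta> < 1"
    proof -
      have n_real: "real n = (real DIM('a) + 1) * (real r - 1)"
        using \<open>r > 0\<close> by (cases r) (simp_all add: n_def algebra_simps)
      have M_real: "real M = real (card \<C>) * real r ^ 2" by (simp add: M_def)
      \<comment> \<open>\<open>\<mu>\<close> is the value at which the tail bound equals the inverse
        of \<open>M ^ n\<close>; the additional 1 makes the union bound strict.\<close>
      have "\<mu>\<^sup>2 = real n * f * ln (real M) / 2"
        unfolding \<mu>_def n_real M_real using \<open>r > 0\<close> M1
        by (intro real_sqrt_pow2) (auto intro!: mult_nonneg_nonneg divide_nonneg_pos simp: f_def)
      moreover have "\<mu>\<^sup>2 < (\<mu> + 1)\<^sup>2" using lam0 by (simp add: power2_eq_square algebra_simps)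
      ultimately have "real n * ln (real M) * f < 2 * (\<mu> + 1)\<^sup>2" by (simp add: mult_ac)
      then have "real n * ln (real M) < 2 * (\<mu> + 1)\<^sup>2 / f" using f by (simp add: pos_less_divide_eq)
      then have "real n * ln (real M) + - 2 * (\<mu> + 1)\<^sup>2 / f < 0" by simp
      then have "exp (real n * ln (real M) + - 2 * (\<mu> + 1)\<^sup>2 / f) < 1" by simp
      moreover have "exp (real n * ln (real M)) = real (M ^ n)"
        using M2 by (simp add: exp_of_nat_mult)
      ultimately show ?thesis unfolding exp_add \<beta>_def by simp
    qed
    have "measure_pmf.prob W (\<Union>t\<in>T ` \<G>. bad t) \<le> (\<Sum>t\<in>T ` \<G>. measure_pmf.prob W (bad t))"
      by (rule measure_pmf.finite_measure_subadditive_finite[OF finT]) auto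
    also have "\<dots> \<le> (\<Sum>t\<in>T ` \<G>. \<beta>)" by (rule sum_mono) (rule bad_le)
    also have "\<dots> = real (card (T ` \<G>)) * \<beta>" by simp
    also have "\<dots> \<le> real (M ^ n) * \<beta>"
      using cardT by (intro mult_right_mono) (simp_all add: \<beta>_def del: of_nat_power)
    also note beta
    finally have "measure_pmf.prob W (\<Union>t\<in>T ` \<G>. bad t) < 1" .
    \<comment> \<open>An event of probability below 1 cannot cover the support, so some labelling in
      the support avoids all bad events.\<close>
    moreover have "measure_pmf.prob W B = 1" if "set_pmf W \<subseteq> B" for B
      using that by (subst measure_pmf.prob_eq_1) (auto simp: AE_measure_pmf_iff)
    ultimately have "\<not> set_pmf W \<subseteq> (\<Union>t\<in>T ` \<G>. bad t)" by (metis less_irrefl)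
    then obtain \<omega> where \<omega>: "\<omega> \<in> set_pmf W" "\<And>G. G \<in> \<G> \<Longrightarrow> \<omega> \<notin> bad (T G)" by blast
    have per: "\<omega> C permutes {1..r}" if C: "C \<in> \<C>" for C
    proof -
      have "set_pmf U = {\<pi>. \<pi> permutes {1..r}}"
        unfolding U_def by (rule set_pmf_of_set) (use permutes_id in \<open>auto simp: finite_permutations simp del: permutes_id\<close>)
      then show ?thesis
        using \<omega>(1) C assms by (auto simp: W_def set_Pi_pmf PiE_dflt_def)
    qed
    have "real (card (hit G \<omega>)) < q * f + (\<mu> + 1)" if G: "G \<in> \<G>" for G
    proof -
      have "e C (\<omega> C j) \<in> X" if "C \<in> \<C>" "j \<in> {1..r}" for C j
        using bij_betwE[OF e[OF that(1)]] permutes_in_image[OF per[OF that(1)], of j] that by (auto simp: X_def)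
      then have "hit G \<omega> = {C \<in> \<C>. \<omega> C permutes {1..r} \<and> (\<forall>j\<in>{1..r}. (j, e C (\<omega> C j)) \<in> T G)}"
        using per by (auto simp: hit_def T_def Hs_def)
      then show ?thesis using \<omega>(2)[OF G] by (simp add: bad_def not_le)
    qed
    then show ?thesis using per by blast
  qed
  then show ?thesis unfolding \<G>_def hit_def Hs_def by (simp add: imp_conjL)
qed

section \<open>Deriving the two bounds from robust labellings and popular permutations\<close>

theorem theorem4p2:
  fixes N r :: nat and \<C> :: "'a::euclidean_space set set"
  assumes "N > 0" and "r > 0"
    and "card \<C> = N" and "disjoint \<C>" and "\<forall>C\<in>\<C>. card C = r"
  shows "(\<exists>P. colorful_partition r \<C> P \<and>
            (\<forall>t::nat. real t \<le> real N - (1 - fixpoint_prob r) * real (max_split r \<C>)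
                - sqrt ((real DIM('a) + 1) * (real r - 1) * real (max_split r \<C>)
                          * ln (real N * real r ^ 2) / 2) - 1 \<longrightarrow>
               (\<forall>S\<subseteq>\<C>. card S = t \<longrightarrow> tverberg (remove_classes S P))))
       \<and> (\<forall>P. colorful_partition r \<C> P \<longrightarrow>
            (\<exists>S\<subseteq>\<C>. real (card S) \<le> real N - 1 / fact r * real (max_split r \<C>) \<and>
                   \<not> tverberg (remove_classes S P)))"
proof (intro conjI allI impI)
  have fin: "finite \<C>" using assms by (intro card_ge_0_finite) simp
  have ne: "\<C> \<noteq> {}" using assms by auto
  have finC: "finite C" if "C \<in> \<C>" for C using assms that by (intro card_ge_0_finite) simp
  define q f \<mu> where "q = 1 - fixpoint_prob r" and "f = real (max_split r \<C>)"
    and "\<mu> = sqrt ((real DIM('a) + 1) * (real r - 1) * f * ln (real N * real r ^ 2) / 2)"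
  have "\<exists>e. \<forall>C\<in>\<C>. bij_betw (e C) {1..r} C"
  proof (intro bchoice ballI)
    fix C assume "C \<in> \<C>"
    then show "\<exists>h. bij_betw h {1..r} C"
      using ex_bij_betw_nat_finite_1[OF finC] assms(5) by fastforce
  qed
  then obtain e where e: "\<And>C. C \<in> \<C> \<Longrightarrow> bij_betw (e C) {1..r} C" by blast
  obtain \<omega> where \<omega>: "\<And>C. C \<in> \<C> \<Longrightarrow> \<omega> C permutes {1..r}"
    and rob: "\<And>G. (\<Sum>j\<in>{1..r}. G j) = 0 \<Longrightarrow> (\<forall>j\<in>{1..r}. fst (G j) \<noteq> 0) \<Longrightarrow>
      real (card {C \<in> \<C>. \<forall>j\<in>{1..r}. G j \<bullet> (e C (\<omega> C j), 1::real) > 0}) < q * f + (\<mu> + 1)"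
    using ex_robust_labelling[OF fin ne assms(2,4) e] unfolding q_def f_def \<mu>_def assms(3) by blast
  define a where "a C j = e C (\<omega> C j)" for C j
  have a: "bij_betw (a C) {1..r} C" if "C \<in> \<C>" for C
    using bij_betw_trans[OF permutes_imp_bij[OF \<omega>[OF that]] e[OF that]] by (simp add: a_def[abs_def] comp_def)
  define A where "A j = (\<lambda>C. a C j) ` \<C>" for j
  have "colorful_partition r \<C> (A ` {1..r})"
    unfolding A_def[abs_def] by (rule colorful_partition_of_bijections[OF ne assms(4) a])
  moreover have "tverberg (remove_classes S (A ` {1..r}))"
    if t: "real (card S) \<le> real N - q * f - \<mu> - 1" and S: "S \<subseteq> \<C>" for S
  proof (rule ccontr)
    assume "\<not> tverberg (remove_classes S (A ` {1..r}))"
    then have disj: "(\<Inter>j\<in>{1..r}. convex hull (A j - \<Union>S)) = {}"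
      by (simp add: tverberg_def remove_classes_def)
    have a_notin: "a C j \<in> A j - \<Union>S" if "C \<in> \<C> - S" "j \<in> {1..r}" for C j
    proof -
      have "a C j \<in> C" using bij_betwE[OF a] that by blast
      moreover have "C \<inter> D = {}" if "D \<in> S" for D
        using S \<open>C \<in> \<C> - S\<close> that by (intro disjointD[OF assms(4)]) auto
      ultimately have "a C j \<notin> \<Union>S" by blast
      then show ?thesis using that by (auto simp: A_def)
    qed
    have "q * f \<ge> 0" by (simp add: q_def f_def fixpoint_prob_def)
    moreover have "\<mu> \<ge> 0"
      unfolding \<mu>_def using assms(1,2) mult_mono[of 1 "real N" 1 "real r ^ 2"]
      by (auto intro!: mult_nonneg_nonneg divide_nonneg_pos simp: f_def)
    \<comment> \<open>The final \<open>- 1\<close> in the bound on \<open>t\<close> guarantees a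
      surviving class, so all parts stay nonempty and a separation with nonzero normals
      exists.\<close>
    ultimately have "card S < card \<C>" using t assms(3) by linarith
    then have "S \<noteq> \<C>" by auto
    then obtain C where C: "C \<in> \<C> - S" using S by auto
    have "\<exists>G. (\<Sum>j\<in>{1..r}. G j) = 0 \<and> (\<forall>j\<in>{1..r}. fst (G j) \<noteq> 0) \<and>
        (\<forall>j\<in>{1..r}. \<forall>x\<in>A j - \<Union>S. G j \<bullet> (x, 1::real) > 0)"
    proof (rule balanced_separation_nonzero[OF assms(2) _ _ disj])
      show "finite (A j - \<Union>S)" for j using fin by (simp add: A_def)
      show "A j - \<Union>S \<noteq> {}" if "j \<in> {1..r}" for j using a_notin[OF C that] by blast
    qed
    then obtain G where G: "(\<Sum>j\<in>{1..r}. G j) = 0" "\<forall>j\<in>{1..r}. fst (G j) \<noteq> 0"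
      "\<And>j x. j \<in> {1..r} \<Longrightarrow> x \<in> A j - \<Union>S \<Longrightarrow> G j \<bullet> (x, 1::real) > 0" by blast
    \<comment> \<open>Every surviving class is hit by \<open>G\<close>, but there are at least
      \<open>q * f + \<mu> + 1\<close> survivors, more than the labelling allows.\<close>
    have "\<C> - S \<subseteq> {C \<in> \<C>. \<forall>j\<in>{1..r}. G j \<bullet> (e C (\<omega> C j), 1::real) > 0}"
      using G(3) a_notin unfolding a_def by blast
    then have "real (card (\<C> - S)) \<le> real (card {C \<in> \<C>. \<forall>j\<in>{1..r}. G j \<bullet> (e C (\<omega> C j), 1::real) > 0})"
      using fin by (intro of_nat_mono card_mono) auto
    also have "\<dots> < q * f + (\<mu> + 1)" by (rule rob[OF G(1,2)])
    finally have "real (card (\<C> - S)) < q * f + (\<mu> + 1)" .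
    moreover have "real (card (\<C> - S)) = real N - real (card S)"
      using card_mono[OF fin S] finite_subset[OF S fin] S assms(3)
      by (simp add: card_Diff_subset of_nat_diff)
    ultimately show False using t by simp
  qed
  ultimately show "\<exists>P. colorful_partition r \<C> P \<and>
      (\<forall>t::nat. real t \<le> real N - (1 - fixpoint_prob r) * real (max_split r \<C>)
        - sqrt ((real DIM('a) + 1) * (real r - 1) * real (max_split r \<C>)
            * ln (real N * real r ^ 2) / 2) - 1 \<longrightarrow>
        (\<forall>S\<subseteq>\<C>. card S = t \<longrightarrow> tverberg (remove_classes S P)))"
    unfolding q_def f_def \<mu>_def by blast
next
  fix P assume P: "colorful_partition r \<C> P"
  have fin: "finite \<C>" using assms by (intro card_ge_0_finite) simp
  obtain H where H: "\<forall>i\<in>{1..r}. halfspace (H i)" "card {C \<in> \<C>. splits r H C} = max_split r \<C>"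
    using max_split_attained[OF fin] by blast
  show "\<exists>S\<subseteq>\<C>. real (card S) \<le> real N - 1 / fact r * real (max_split r \<C>) \<and>
      \<not> tverberg (remove_classes S P)"
  proof (cases "{C \<in> \<C>. splits r H C} = {}")
    case True
    \<comment> \<open>If nothing is split, the maximum is 0 and all classes may be removed; what is
      left is the empty part, whose hull is empty.\<close>
    have "\<Union>P = \<Union>\<C>" "P \<noteq> {}" using P assms(2) by (auto simp: colorful_partition_def partition_on_def)
    then have "remove_classes \<C> P = {{}}" by (auto simp: remove_classes_def)
    then have "\<not> tverberg (remove_classes \<C> P)" by (simp add: tverberg_def)
    moreover have "max_split r \<C> = 0" using H(2) True by simp
    ultimately show ?thesis using assms(3) by (intro exI[of _ \<C>]) simp
  next
    case False
    show ?thesis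
      using colorful_removal[OF fin _ assms(2) P _ False] H assms(3,5) by simp
  qed
qed

end
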